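(* For each $n\in\mathbb{N}$ let $(\mathcal{M}^{n}_t)_{t\ge0}$ be a monotone Mallows process on $\mathcal{S}_n$ with jumping times $T_1,\dots,T_{\binom n2}$ (depending on $n$). Then for every fixed $k\in\mathbb{N}$, as $n\to\infty$, $nT_k$ converges in distribution to a $\mathrm{Gamma}(k,1)$ random variable. Moreover, if each $(\mathcal{M}^n_t)_{t\ge0}$ is regular, then for every fixed $k\in\mathbb{N}$, $(nT_1,\dots,nT_k)$ converges in distribution, as $n\to\infty$, to the law of the first $k$ points of a homogeneous Poisson point process on $[0,\infty)$ with rate $1$.
   Context: $\mathrm{Inv}(\sigma)=|\{i<j:\sigma(i)>\sigma(j)\}|$, $\mathrm{Inv}_j(\sigma)=|\{i\in[j-1]:\sigma(i)>\sigma(j)\}|$ for $\sigma\in\mathcal{S}_n$. The Mallows distribution $\pi_{n,q}(\sigma)=q^{\mathrm{Inv}(\sigma)}/\prod_{k=1}^n\sum_{\ell=0}^{k-1}q^\ell$ ($0^0=1$). A Mallows process is an $\mathcal{S}_n$-valued càdlàg process with $\mathcal{M}_t\sim\pi_{n,t}$ for every $t\ge0$. It is monotone if $\mathrm{Inv}(\mathcal{M}_t)\le\mathrm{Inv}(\mathcal{M}_{t'})$ for all $t<t'$; strongly monotone if $t\mapsto\mathrm{Inv}_j(\mathcal{M}_t)$ is nondecreasing for each $j$; smooth if strongly monotone and $\mathrm{Inv}(\mathcal{M}_t)\le\mathrm{Inv}(\mathcal{M}_{t-})+1$ for all $t$; regular if smooth and the processes $(\mathrm{Inv}_j(\mathcal{M}_t))_{t\ge0}$,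 $j\in[n]$, are mutually independent. For a monotone Mallows process, the jumping times are $T_k=\inf\{t\ge0:\mathrm{Inv}(\mathcal{M}_t)\ge k\}$ for $0\le k\le\binom n2$. *)

theory Defs
  imports "HOL-Probability.Probability" "HOL-Combinatorics.Permutations"
begin

text \<open>Permutations of [n] = {1..n} are functions nat => nat that permute {1..n}.\<close>

definition inversions :: "nat \<Rightarrow> (nat \<Rightarrow> nat) \<Rightarrow> nat" where
  "inversions n \<sigma> = card {(i, j). i \<in> {1..n} \<and> j \<in> {1..n} \<and> i < j \<and> \<sigma> i > \<sigma> j}"

definition inversions_at :: "(nat \<Rightarrow> nat) \<Rightarrow> nat \<Rightarrow> nat" where
  "inversions_at \<sigma> j = card {i \<in> {1..<j}. \<sigma> i > \<sigma> j}"

text \<open>Mallows probability pi_{n,q}(sigma); note 0 ^ 0 = 1 in Isabelle.\<close>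
definition mallows :: "nat \<Rightarrow> real \<Rightarrow> (nat \<Rightarrow> nat) \<Rightarrow> real" where
  "mallows n q \<sigma> = q ^ inversions n \<sigma> / (\<Prod>k=1..n. \<Sum>l<k. q ^ l)"

text \<open>Cadlag path on [0,oo) with values in S_n (topology: product topology on nat => nat,
  which is discrete on the finite set S_n).\<close>
definition cadlag :: "(real \<Rightarrow> 'b::topological_space) \<Rightarrow> bool" where
  "cadlag f \<longleftrightarrow> (\<forall>t\<ge>0. (f \<longlongrightarrow> f t) (at_right t)) \<and> (\<forall>t>0. \<exists>l. (f \<longlongrightarrow> l) (at_left t))"

definition left_limit :: "(real \<Rightarrow> 'b::topological_space) \<Rightarrow> real \<Rightarrow> 'b" where
  "left_limit f t = (THE l. (f \<longlongrightarrow> l) (at_left t))"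

definition mallows_process :: "nat \<Rightarrow> 'a measure \<Rightarrow> (real \<Rightarrow> 'a \<Rightarrow> (nat \<Rightarrow> nat)) \<Rightarrow> bool" where
  "mallows_process n \<Omega> X \<longleftrightarrow>
     (\<forall>t\<ge>0. \<forall>\<omega>\<in>space \<Omega>. X t \<omega> permutes {1..n}) \<and>
     (\<forall>t\<ge>0. X t \<in> measurable \<Omega> (count_space UNIV)) \<and>
     (\<forall>\<omega>\<in>space \<Omega>. cadlag (\<lambda>t. X t \<omega>)) \<and>
     (\<forall>t\<ge>0. \<forall>\<sigma>. \<sigma> permutes {1..n} \<longrightarrow>
        measure \<Omega> {\<omega>\<in>space \<Omega>. X t \<omega> = \<sigma>} = mallows n t \<sigma>)"

definition monotone_mallows_process :: "nat \<Rightarrow> 'a measure \<Rightarrow> (real \<Rightarrow> 'a \<Rightarrow> (nat \<Rightarrow> nat)) \<Rightarrow> bool" where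
  "monotone_mallows_process n \<Omega> X \<longleftrightarrow> mallows_process n \<Omega> X \<and>
     (\<forall>\<omega>\<in>space \<Omega>. \<forall>t t'. 0 \<le> t \<and> t < t' \<longrightarrow> inversions n (X t \<omega>) \<le> inversions n (X t' \<omega>))"

definition strongly_monotone_mallows_process :: "nat \<Rightarrow> 'a measure \<Rightarrow> (real \<Rightarrow> 'a \<Rightarrow> (nat \<Rightarrow> nat)) \<Rightarrow> bool" where
  "strongly_monotone_mallows_process n \<Omega> X \<longleftrightarrow> mallows_process n \<Omega> X \<and>
     (\<forall>\<omega>\<in>space \<Omega>. \<forall>j\<in>{1..n}. \<forall>t t'. 0 \<le> t \<and> t \<le> t' \<longrightarrow>
        inversions_at (X t \<omega>) j \<le> inversions_at (X t' \<omega>) j)"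

definition smooth_mallows_process :: "nat \<Rightarrow> 'a measure \<Rightarrow> (real \<Rightarrow> 'a \<Rightarrow> (nat \<Rightarrow> nat)) \<Rightarrow> bool" where
  "smooth_mallows_process n \<Omega> X \<longleftrightarrow> strongly_monotone_mallows_process n \<Omega> X \<and>
     (\<forall>\<omega>\<in>space \<Omega>. \<forall>t>0. inversions n (X t \<omega>) \<le> inversions n (left_limit (\<lambda>s. X s \<omega>) t) + 1)"

definition regular_mallows_process :: "nat \<Rightarrow> 'a measure \<Rightarrow> (real \<Rightarrow> 'a \<Rightarrow> (nat \<Rightarrow> nat)) \<Rightarrow> bool" where
  "regular_mallows_process n \<Omega> X \<longleftrightarrow> smooth_mallows_process n \<Omega> X \<and>
     prob_space.indep_vars \<Omega> (\<lambda>j. Pi\<^sub>M {0..} (\<lambda>_. count_space UNIV))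
       (\<lambda>j \<omega>. \<lambda>t\<in>{0::real..}. inversions_at (X t \<omega>) j) {1..n}"

definition jump_time :: "nat \<Rightarrow> (real \<Rightarrow> 'a \<Rightarrow> (nat \<Rightarrow> nat)) \<Rightarrow> nat \<Rightarrow> 'a \<Rightarrow> real" where
  "jump_time n X k \<omega> = Inf {t. 0 \<le> t \<and> k \<le> inversions n (X t \<omega>)}"

definition weak_conv_top :: "(nat \<Rightarrow> 'b::topological_space measure) \<Rightarrow> 'b measure \<Rightarrow> bool" where
  "weak_conv_top P L \<longleftrightarrow> (\<forall>f :: 'b \<Rightarrow> real. continuous_on UNIV f \<and> bounded (range f) \<longrightarrow>
      (\<lambda>n. integral\<^sup>L (P n) f) \<longlonglongrightarrow> integral\<^sup>L L f)"

text \<open>Gamma(k,1) law (k >= 1): Erlang density with shape k, rate 1.\<close>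
definition gamma_law :: "nat \<Rightarrow> real measure" where
  "gamma_law k = density lborel (erlang_density (k - 1) 1)"

text \<open>Law of the first k points of a homogeneous rate-1 Poisson point process on [0,oo):
  the points are the partial sums E_0, E_0+E_1, ..., E_0+...+E_{k-1} of i.i.d. Exp(1)
  inter-arrival times. A k-vector is encoded as a function nat => real, coordinate i < k
  holding the (i+1)-st point and all other coordinates equal to 0.\<close>
definition poisson_first_points :: "nat \<Rightarrow> (nat \<Rightarrow> real) measure" where
  "poisson_first_points k =
     distr (Pi\<^sub>M {..<k} (\<lambda>_. density lborel (exponential_density 1))) borel
       (\<lambda>E i. if i < k then (\<Sum>j\<le>i. E j) else 0)"

end

theory Submission
  imports Defs "HOL-Real_Asymp.Real_Asymp"
begin

text \<open>By the Lehmer code, under the Mallows law the numbers \<open>inversions_at \<sigma> j\<close> are independent truncated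
  geometric variables. At time \<open>x / n\<close> each of them is nonzero with probability about \<open>x / n\<close> and
  at least 2 with probability \<open>O(1 / n\<^sup>2)\<close>, so their sum is asymptotically Poisson with mean \<open>x\<close>. By
  monotonicity and right continuity \<open>T\<^sub>k \<le> x / n\<close> means that the sum is at least \<open>k\<close> at time \<open>x / n\<close>,
  which is the Gamma limit. In the regular case the probability that \<open>n T\<^sub>1, \<dots>, n T\<^sub>k\<close> lie in given
  disjoint consecutive grid intervals is bounded below by summing, over injective choices of the
  indices that jump, a product of probabilities for single indices. All limits need only lower bounds:
  the total masses are 1, so no mass can be left over.\<close>

section \<open>The Lehmer code of a Mallows permutation\<close>

text \<open>No cell probability is computed exactly in the regular case; two one-sided bounds meet.
  The \<open>k\<close>-th Poisson point is the last of \<open>k\<close> points with joint density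
  \<open>exp (- y)\<close>, \<open>y\<close> being the last point, so a cell of mesh
  \<open>1 / m\<close> has mass at most its volume times this density at the left end of the last
  interval. On the Mallows side, a given choice of jumping indices has probability about
  \<open>(1 / (m * n)) ^ k\<close> times the probability that all other indices stay 0 up to the
  right end \<open>x\<close> of the last interval, about \<open>exp (- x)\<close>; the roughly
  \<open>n ^ k\<close> choices restore the volume. The two ends are \<open>1 / m\<close> apart. This
  is the origin of the factor \<open>exp (- 1 / real m)\<close> in the cell estimates, which
  disappears when the mesh is refined. A second obstacle is that \<open>jump_time\<close> is the
  infimum of a set that may be empty. For small \<open>n\<close> the level \<open>k\<close> may be
  out of reach altogether, and for large \<open>n\<close> it is reached only almost surely, so
  statements on jump times either carry a witness time or exclude a null set.\<close>

lemma inversions_eq_sum_inversions_at: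
  "inversions n \<sigma> = (\<Sum>j\<in>{1..n}. inversions_at \<sigma> j)"
proof -
  have "{(i, j). i \<in> {1..n} \<and> j \<in> {1..n} \<and> i < j \<and> \<sigma> i > \<sigma> j}
      = (\<lambda>(j, i). (i, j)) ` (SIGMA j:{1..n}. {i \<in> {1..<j}. \<sigma> i > \<sigma> j})"
    by (auto simp: image_iff)
  then have "inversions n \<sigma> = card (SIGMA j:{1..n}. {i \<in> {1..<j}. \<sigma> i > \<sigma> j})"
    by (simp add: inversions_def card_image inj_on_def split_def prod_eq_iff)
  then show ?thesis
    by (simp add: inversions_at_def)
qed

lemma inversions_at_less: "j \<ge> 1 \<Longrightarrow> inversions_at \<sigma> j < j"
proof -
  assume "j \<ge> 1"
  have "inversions_at \<sigma> j \<le> card {1..<j}"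
    unfolding inversions_at_def by (intro card_mono) auto
  with \<open>j \<ge> 1\<close> show ?thesis by simp
qed

text \<open>Restricted to \<open>{1..n}\<close> so that codes lie in an extensional product
  \<open>PiE\<close>, where they can be counted.\<close>

definition lehmer_code :: "nat \<Rightarrow> (nat \<Rightarrow> nat) \<Rightarrow> nat \<Rightarrow> nat" where
  "lehmer_code n \<sigma> = (\<lambda>j\<in>{1..n}. inversions_at \<sigma> j)"

text \<open>Insertion argument, by induction on \<open>m\<close>: once the relative order of the
  first \<open>m\<close> values is known, the number of them exceeding the next value fixes the slot
  into which it is inserted.\<close>

lemma order_eq_if_inversions_at_eq:
  assumes inj: "inj_on \<sigma> {1..n}" "inj_on \<tau> {1..n}"
    and eq: "\<And>j. j \<in> {1..n} \<Longrightarrow> inversions_at \<sigma> j = inversions_at \<tau> j"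
    and "m \<le> n" "a \<in> {1..m}" "b \<in> {1..m}"
  shows "\<sigma> a < \<sigma> b \<longleftrightarrow> \<tau> a < \<tau> b"
  using assms(4-)
proof (induction m arbitrary: a b)
  case (Suc m)
  let ?j = "Suc m"
  let ?A = "{i \<in> {1..m}. \<sigma> i > \<sigma> ?j}" and ?B = "{i \<in> {1..m}. \<tau> i > \<tau> ?j}"
  have IH: "\<sigma> a < \<sigma> b \<longleftrightarrow> \<tau> a < \<tau> b" if "a \<in> {1..m}" "b \<in> {1..m}" for a b
    using Suc.IH Suc.prems(1) that by auto
  have card: "card ?A = card ?B"
    using eq[of ?j] Suc.prems(1)
    by (simp add: inversions_at_def atLeastLessThanSuc_atLeastAtMost)
  \<comment> \<open>Both are upper sets of the same linear order on \<open>{1..m}\<close>, hence nested.\<close>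
  have "?A \<subseteq> ?B \<or> ?B \<subseteq> ?A"
  proof (rule ccontr)
    assume "\<not> ?thesis"
    then obtain a b where ab: "a \<in> ?A" "a \<notin> ?B" "b \<in> ?B" "b \<notin> ?A" by blast
    then have "\<sigma> b < \<sigma> a" "\<tau> a < \<tau> b" by auto
    moreover have "\<sigma> a < \<sigma> b \<longleftrightarrow> \<tau> a < \<tau> b" using ab by (intro IH) auto
    ultimately show False by simp
  qed
  then have AB: "?A = ?B"
    using card card_subset_eq[of ?B ?A] card_subset_eq[of ?A ?B] by auto
  have ne: "\<sigma> i \<noteq> \<sigma> ?j" "\<tau> i \<noteq> \<tau> ?j" if "i \<in> {1..m}" for i
    using that inj_onD[OF inj(1), of i ?j] inj_onD[OF inj(2), of i ?j] Suc.prems(1) by auto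
  have gt: "\<sigma> i > \<sigma> ?j \<longleftrightarrow> \<tau> i > \<tau> ?j" if "i \<in> {1..m}" for i
    using AB that by blast
  have lt: "\<sigma> i < \<sigma> ?j \<longleftrightarrow> \<tau> i < \<tau> ?j" if "i \<in> {1..m}" for i
    using gt[OF that] ne[OF that] by linarith
  from Suc.prems(2,3) consider "a \<in> {1..m}" "b \<in> {1..m}" | "a = ?j" "b \<in> {1..m}"
    | "a \<in> {1..m}" "b = ?j" | "a = ?j" "b = ?j" by fastforce
  then show ?case by cases (use IH gt lt in auto)
qed auto

text \<open>The values fill \<open>{1..n}\<close>, so each one equals its rank. This turns equality
  of relative orders into equality of permutations.\<close>

lemma permutes_eq_card_less:
  assumes "\<sigma> permutes {1..n}" "a \<in> {1..n}"
  shows "\<sigma> a = Suc (card {b \<in> {1..n}. \<sigma> b < \<sigma> a})"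
proof -
  have img: "\<sigma> ` {1..n} = {1..n}" and inj: "inj_on \<sigma> {1..n}"
    using assms permutes_image permutes_inj_on by blast+
  have a: "\<sigma> a \<in> {1..n}" using assms img by blast
  have "\<sigma> ` {b \<in> {1..n}. \<sigma> b < \<sigma> a} = {1..<\<sigma> a}"
  proof -
    have "\<sigma> ` {b \<in> {1..n}. \<sigma> b < \<sigma> a} = {v \<in> \<sigma> ` {1..n}. v < \<sigma> a}" by auto
    also have "\<dots> = {1..<\<sigma> a}" unfolding img using a by auto
    finally show ?thesis .
  qed
  moreover have "card (\<sigma> ` {b \<in> {1..n}. \<sigma> b < \<sigma> a}) = card {b \<in> {1..n}. \<sigma> b < \<sigma> a}"
    by (intro card_image inj_on_subset[OF inj]) auto
  ultimately have "card {b \<in> {1..n}. \<sigma> b < \<sigma> a} = \<sigma> a - 1" by simp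
  then show ?thesis using a by simp
qed

lemma inj_on_lehmer_code: "inj_on (lehmer_code n) {\<sigma>. \<sigma> permutes {1..n}}"
proof (rule inj_onI)
  fix \<sigma> \<tau> assume st: "\<sigma> \<in> {\<sigma>. \<sigma> permutes {1..n}}" "\<tau> \<in> {\<sigma>. \<sigma> permutes {1..n}}"
    and eq: "lehmer_code n \<sigma> = lehmer_code n \<tau>"
  have eq': "inversions_at \<sigma> j = inversions_at \<tau> j" if "j \<in> {1..n}" for j
    using fun_cong[OF eq, of j] that by (simp add: lehmer_code_def)
  have order: "\<sigma> a < \<sigma> b \<longleftrightarrow> \<tau> a < \<tau> b" if "a \<in> {1..n}" "b \<in> {1..n}" for a b
    using st that by (intro order_eq_if_inversions_at_eq[of \<sigma> n \<tau> n] eq') (auto intro: permutes_inj_on)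
  show "\<sigma> = \<tau>"
  proof
    fix a show "\<sigma> a = \<tau> a"
    proof (cases "a \<in> {1..n}")
      case True
      then have "{b \<in> {1..n}. \<sigma> b < \<sigma> a} = {b \<in> {1..n}. \<tau> b < \<tau> a}" using order by blast
      with True st permutes_eq_card_less[of \<sigma> n a] permutes_eq_card_less[of \<tau> n a]
      show ?thesis by simp
    next
      case False
      with st show ?thesis by (simp add: permutes_not_in)
    qed
  qed
qed

text \<open>Surjectivity needs no inverse construction: the code is injective and both sides have
  \<open>fact n\<close> elements.\<close>

lemma bij_betw_lehmer_code:
  "bij_betw (lehmer_code n) {\<sigma>. \<sigma> permutes {1..n}} (\<Pi>\<^sub>E j\<in>{1..n}. {..<j})"
proof -
  let ?S = "{\<sigma>. \<sigma> permutes {1..n}}"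
  have sub: "lehmer_code n ` ?S \<subseteq> (\<Pi>\<^sub>E j\<in>{1..n}. {..<j})"
    by (auto simp: lehmer_code_def inversions_at_less)
  have "card (lehmer_code n ` ?S) = card ?S"
    by (rule card_image[OF inj_on_lehmer_code])
  also have "\<dots> = fact n"
    by (rule card_permutations) auto
  also have "\<dots> = card (\<Pi>\<^sub>E j\<in>{1..n}. {..<j})"
    by (simp add: card_PiE fact_prod)
  finally have "lehmer_code n ` ?S = (\<Pi>\<^sub>E j\<in>{1..n}. {..<j})"
    using sub by (intro card_subset_eq finite_PiE) auto
  then show ?thesis
    using inj_on_lehmer_code by (simp add: bij_betw_def)
qed

text \<open>The algebraic form of independence of the code entries: a product weight on permutations
  becomes a product weight on a product set.\<close>

lemma sum_permutes_prod_inversions_at: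
  fixes g :: "nat \<Rightarrow> nat \<Rightarrow> 'a::comm_semiring_1"
  shows "(\<Sum>\<sigma> | \<sigma> permutes {1..n}. \<Prod>j\<in>{1..n}. g j (inversions_at \<sigma> j)) = (\<Prod>j\<in>{1..n}. \<Sum>l<j. g j l)"
proof -
  have "(\<Prod>j\<in>{1..n}. \<Sum>l<j. g j l) = (\<Sum>c\<in>(\<Pi>\<^sub>E j\<in>{1..n}. {..<j}). \<Prod>j\<in>{1..n}. g j (c j))"
    by (intro prod_sum_PiE) auto
  also have "\<dots> = (\<Sum>\<sigma> | \<sigma> permutes {1..n}. \<Prod>j\<in>{1..n}. g j (lehmer_code n \<sigma> j))"
    by (rule sum.reindex_bij_betw[OF bij_betw_lehmer_code, symmetric])
  also have "\<dots> = (\<Sum>\<sigma> | \<sigma> permutes {1..n}. \<Prod>j\<in>{1..n}. g j (inversions_at \<sigma> j))"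
    by (intro sum.cong prod.cong) (auto simp: lehmer_code_def)
  finally show ?thesis ..
qed

text \<open>Counts only the permutations whose code has entries 0 and 1, with ones on a set of size
  \<open>m\<close> inside \<open>{2..n}\<close>; the entry at index 1 is always 0. At
  \<open>q = x / n\<close> this lower bound is asymptotically sharp.\<close>

lemma binomial_le_card_inversions:
  "(n - 1) choose m \<le> card {\<sigma>. \<sigma> permutes {1..n} \<and> inversions n \<sigma> = m}"
proof -
  let ?C = "\<lambda>A. \<lambda>j\<in>{1..n}. if j \<in> A then 1 else 0::nat"
  let ?h = "inv_into {\<sigma>. \<sigma> permutes {1..n}} (lehmer_code n)"
  let ?F = "{A. A \<subseteq> {2..n} \<and> card A = m}"
  have bij: "bij_betw ?h (\<Pi>\<^sub>E j\<in>{1..n}. {..<j}) {\<sigma>. \<sigma> permutes {1..n}}"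
    by (rule bij_betw_inv_into[OF bij_betw_lehmer_code])
  have C: "?C A \<in> (\<Pi>\<^sub>E j\<in>{1..n}. {..<j})" if "A \<in> ?F" for A
    using that by force
  have "inj_on (\<lambda>A. ?h (?C A)) ?F"
  proof (rule inj_onI)
    fix A B assume AB: "A \<in> ?F" "B \<in> ?F" "?h (?C A) = ?h (?C B)"
    then have CAB: "?C A = ?C B"
      using C[OF AB(1)] C[OF AB(2)] bij inj_onD[of ?h] unfolding bij_betw_def by blast
    have "j \<in> A \<longleftrightarrow> j \<in> B" if "j \<in> {1..n}" for j
      using fun_cong[OF CAB, of j] that by (cases "j \<in> A"; cases "j \<in> B") simp_all
    moreover have "{2..n} \<subseteq> {1..n}" by auto
    with AB(1,2) have "A \<subseteq> {1..n}" "B \<subseteq> {1..n}" by blast+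
    ultimately show "A = B" by blast
  qed
  moreover have "(\<lambda>A. ?h (?C A)) ` ?F \<subseteq> {\<sigma>. \<sigma> permutes {1..n} \<and> inversions n \<sigma> = m}"
  proof (rule image_subsetI)
    fix A assume A: "A \<in> ?F"
    let ?\<sigma> = "?h (?C A)"
    have "?C A \<in> lehmer_code n ` {\<sigma>. \<sigma> permutes {1..n}}"
      using C[OF A] bij_betw_lehmer_code[of n] by (simp add: bij_betw_def)
    then have code: "lehmer_code n ?\<sigma> = ?C A" by (rule f_inv_into_f)
    have perm: "?\<sigma> permutes {1..n}"
      using bij_betwE[OF bij] C[OF A] by blast
    have "inversions n ?\<sigma> = (\<Sum>j\<in>{1..n}. lehmer_code n ?\<sigma> j)"
      by (simp add: inversions_eq_sum_inversions_at lehmer_code_def)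
    also have "\<dots> = (\<Sum>j\<in>{1..n}. if j \<in> A then 1 else 0)"
      unfolding code by (intro sum.cong) auto
    also have "\<dots> = card ({1..n} \<inter> A)"
      by (simp flip: sum.inter_restrict)
    also have "{1..n} \<inter> A = A"
      using A atLeastatMost_subset_iff[of 2 n 1 n] by auto
    finally have "inversions n ?\<sigma> = card A" .
    with perm A show "?\<sigma> \<in> {\<sigma>. \<sigma> permutes {1..n} \<and> inversions n \<sigma> = m}"
      by blast
  qed
  moreover have "finite {\<sigma>. \<sigma> permutes {1..n} \<and> inversions n \<sigma> = m}"
    using finite_permutations[of "{1..n}"] by simp
  ultimately have "card ?F \<le> card {\<sigma>. \<sigma> permutes {1..n} \<and> inversions n \<sigma> = m}"
    by (rule card_inj_on_le)
  then show ?thesis by (simp add: n_subsets)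
qed

section \<open>q-integers, whose product is the normalising constant, and the law of one code
  entry\<close>

abbreviation qint :: "real \<Rightarrow> nat \<Rightarrow> real" where
  "qint q k \<equiv> (\<Sum>l<k. q ^ l)"

lemma qint_ge_1: "0 \<le> q \<Longrightarrow> 1 \<le> k \<Longrightarrow> 1 \<le> qint q k"
  using sum_mono2[of "{..<k}" "{0}" "\<lambda>l. q ^ l"] by auto

lemma qint_ge_1_plus: "0 \<le> q \<Longrightarrow> 2 \<le> k \<Longrightarrow> 1 + q \<le> qint q k"
  using sum_mono2[of "{..<k}" "{..<2}" "\<lambda>l. q ^ l"] by (auto simp: numeral_2_eq_2)

lemma qint_le: "0 \<le> q \<Longrightarrow> q < 1 \<Longrightarrow> qint q k \<le> 1 / (1 - q)"
  by (subst sum_gp_strict) (auto simp: divide_right_mono)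

lemma qint_le_inverse: "0 \<le> q \<Longrightarrow> q < 1 \<Longrightarrow> 1 \<le> k \<Longrightarrow> 1 - q \<le> 1 / qint q k"
  using qint_le[of q k] qint_ge_1[of q k] by (simp add: field_simps)

text \<open>All terms of the difference are nonnegative; keeping only the linear one already gives
  the jump rate to first order.\<close>

lemma qint_diff_ge:
  assumes "0 \<le> a" "a \<le> b" "2 \<le> k"
  shows "b - a \<le> qint b k - qint a k"
proof -
  have "b - a \<le> (\<Sum>l<2. b ^ l - a ^ l)" by (simp add: numeral_2_eq_2)
  also have "\<dots> \<le> (\<Sum>l<k. b ^ l - a ^ l)"
    using assms by (intro sum_mono2) (auto intro: power_mono)
  finally show ?thesis by (simp add: sum_subtractf)
qed

lemma mallows_eq_prod:
  "mallows n q \<sigma> = (\<Prod>j\<in>{1..n}. q ^ inversions_at \<sigma> j / qint q j)"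
  by (simp add: mallows_def inversions_eq_sum_inversions_at power_sum prod_dividef)

lemma sum_mallows_inversions_at:
  assumes "0 \<le> q" "j \<in> {1..n}"
  shows "(\<Sum>\<sigma> | \<sigma> permutes {1..n} \<and> inversions_at \<sigma> j \<in> L. mallows n q \<sigma>)
    = (\<Sum>l | l < j \<and> l \<in> L. q ^ l) / qint q j"
proof -
  \<comment> \<open>The restriction to \<open>L\<close> is encoded as a zero in the factor at
    \<open>j\<close>, so the sum over permutations still factorises and every factor except the one
    at \<open>j\<close> sums to 1.\<close>
  let ?g = "\<lambda>i l. (if i = j \<and> l \<notin> L then 0 else q ^ l / qint q i)"
  have "(\<Sum>\<sigma> | \<sigma> permutes {1..n} \<and> inversions_at \<sigma> j \<in> L. mallows n q \<sigma>)
     = (\<Sum>\<sigma> | \<sigma> permutes {1..n}. if inversions_at \<sigma> j \<in> L then mallows n q \<sigma> else 0)"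
    by (subst sum.inter_filter[symmetric]) (auto intro: finite_permutations)
  also have "\<dots> = (\<Sum>\<sigma> | \<sigma> permutes {1..n}. \<Prod>i\<in>{1..n}. ?g i (inversions_at \<sigma> i))"
  proof (intro sum.cong refl)
    fix \<sigma>
    show "(if inversions_at \<sigma> j \<in> L then mallows n q \<sigma> else 0) = (\<Prod>i\<in>{1..n}. ?g i (inversions_at \<sigma> i))"
    proof (cases "inversions_at \<sigma> j \<in> L")
      case True
      then show ?thesis by (auto simp: mallows_eq_prod intro!: prod.cong)
    next
      case False
      then have "(\<Prod>i\<in>{1..n}. ?g i (inversions_at \<sigma> i)) = 0"
        using assms(2) by (intro prod_zero) (auto intro!: bexI[of _ j])
      with False show ?thesis by simp
    qed
  qed
  also have "\<dots> = (\<Prod>i\<in>{1..n}. \<Sum>l<i. ?g i l)"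
    by (rule sum_permutes_prod_inversions_at)
  also have "\<dots> = (\<Sum>l<j. ?g j l) * (\<Prod>i\<in>{1..n} - {j}. \<Sum>l<i. ?g i l)"
    using assms(2) by (intro prod.remove) auto
  also have "(\<Prod>i\<in>{1..n} - {j}. \<Sum>l<i. ?g i l) = 1"
  proof (rule prod.neutral, rule ballI)
    fix i assume "i \<in> {1..n} - {j}"
    then show "(\<Sum>l<i. ?g i l) = 1"
      using qint_ge_1[of q i] assms(1) by (auto simp flip: sum_divide_distrib)
  qed
  also have "(\<Sum>l<j. ?g j l) = (\<Sum>l<j. if l \<in> L then q ^ l / qint q j else 0)"
    by (intro sum.cong) auto
  also have "\<dots> = (\<Sum>l | l < j \<and> l \<in> L. q ^ l / qint q j)"
    by (subst sum.inter_filter[symmetric]) auto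
  finally show ?thesis
    by (simp add: sum_divide_distrib)
qed

section \<open>Jumping times of monotone Mallows processes\<close>

context
  fixes n :: nat and \<Omega> :: "'a measure" and X :: "real \<Rightarrow> 'a \<Rightarrow> nat \<Rightarrow> nat"
  assumes prob: "prob_space \<Omega>" and mallows: "mallows_process n \<Omega> X"
begin

interpretation prob_space \<Omega> by (rule prob)

lemma mallows_process_pred_sets: "0 \<le> t \<Longrightarrow> {\<omega> \<in> space \<Omega>. Q (X t \<omega>)} \<in> sets \<Omega>"
proof -
  assume "0 \<le> t"
  then have "X t \<in> measurable \<Omega> (count_space UNIV)"
    using mallows by (auto simp: mallows_process_def)
  from measurable_sets[OF this, of "Collect Q"] show ?thesis
    by (simp add: vimage_def Int_def conj_commute)
qed

lemma mallows_process_prob: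
  assumes "0 \<le> t"
  shows "prob {\<omega> \<in> space \<Omega>. Q (X t \<omega>)} = (\<Sum>\<sigma> | \<sigma> permutes {1..n} \<and> Q \<sigma>. mallows n t \<sigma>)"
proof -
  let ?S = "{\<sigma>. \<sigma> permutes {1..n} \<and> Q \<sigma>}"
  have fin: "finite ?S" by (rule finite_subset[OF _ finite_permutations[of "{1..n}"]]) auto
  have "{\<omega> \<in> space \<Omega>. Q (X t \<omega>)} = (\<Union>\<sigma>\<in>?S. {\<omega> \<in> space \<Omega>. X t \<omega> = \<sigma>})"
    using mallows assms by (auto simp: mallows_process_def)
  also have "prob \<dots> = (\<Sum>\<sigma>\<in>?S. prob {\<omega> \<in> space \<Omega>. X t \<omega> = \<sigma>})"
    by (intro finite_measure_finite_Union fin)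
      (auto simp: disjoint_family_on_def intro!: mallows_process_pred_sets assms)
  also have "\<dots> = (\<Sum>\<sigma>\<in>?S. mallows n t \<sigma>)"
    using mallows assms by (intro sum.cong) (auto simp: mallows_process_def)
  finally show ?thesis .
qed

lemma prob_inversions_at:
  assumes "0 \<le> t" "j \<in> {1..n}"
  shows "prob {\<omega> \<in> space \<Omega>. inversions_at (X t \<omega>) j \<in> L} = (\<Sum>l | l < j \<and> l \<in> L. t ^ l) / qint t j"
  using mallows_process_prob[OF assms(1), of "\<lambda>\<sigma>. inversions_at \<sigma> j \<in> L"] sum_mallows_inversions_at[OF assms]
  by simp

lemma prob_inversions_at_eq_0:
  assumes "0 \<le> t" "j \<in> {1..n}"
  shows "prob {\<omega> \<in> space \<Omega>. inversions_at (X t \<omega>) j = 0} = 1 / qint t j"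
proof -
  have "{l. l < j \<and> l \<in> {0}} = {0}" using assms by auto
  with prob_inversions_at[OF assms, of "{0}"] show ?thesis by simp
qed

text \<open>The exact value is \<open>1 - (1 + t) / qint t j\<close>, and
  \<open>1 / qint t j \<ge> 1 - t\<close>. At \<open>t = x / n\<close> double jumps of one index
  thus have order \<open>1 / n\<^sup>2\<close>, against order \<open>1 / n\<close> for a single
  jump.\<close>

lemma prob_inversions_at_ge_2:
  assumes "0 \<le> t" "t < 1" "j \<in> {2..n}"
  shows "prob {\<omega> \<in> space \<Omega>. 2 \<le> inversions_at (X t \<omega>) j} \<le> t\<^sup>2"
proof -
  have j: "j \<in> {1..n}" using assms by auto
  have pos: "1 \<le> qint t j" using assms by (intro qint_ge_1) auto
  have "{l. l < j \<and> 2 \<le> l} = {..<j} - {..<2}" by auto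
  then have "(\<Sum>l | l < j \<and> l \<in> {2..}. t ^ l) = qint t j - qint t 2"
    using assms sum_diff[of "{..<j}" "{..<2}" "\<lambda>l. t ^ l"] by simp
  then have "prob {\<omega> \<in> space \<Omega>. 2 \<le> inversions_at (X t \<omega>) j} = 1 - (1 + t) * (1 / qint t j)"
    using prob_inversions_at[OF assms(1) j, of "{2..}"] pos
    by (simp add: diff_divide_distrib numeral_2_eq_2)
  also have "\<dots> \<le> 1 - (1 + t) * (1 - t)"
    using assms qint_le_inverse[of t j] by (intro diff_left_mono mult_left_mono) auto
  finally show ?thesis by (simp add: algebra_simps power2_eq_square)
qed

text \<open>Two losses only: permutations with a code entry above 1 are dropped, and each
  \<open>1 / qint t k\<close> is replaced by \<open>1 - t\<close>. At \<open>t = x / n\<close> the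
  left side tends to the Poisson weight.\<close>

lemma prob_inversions_lower_bound:
  assumes "0 \<le> t" "t < 1"
  shows "real ((n - 1) choose m) * t ^ m * (1 - t) ^ n \<le> prob {\<omega> \<in> space \<Omega>. inversions n (X t \<omega>) = m}"
proof -
  let ?Z = "\<Prod>k=1..n. qint t k" and ?S = "{\<sigma>. \<sigma> permutes {1..n} \<and> inversions n \<sigma> = m}"
  have "(1 - t) ^ n = (\<Prod>k=1..n. 1 - t)" by simp
  also have "\<dots> \<le> (\<Prod>k=1..n. 1 / qint t k)"
    using assms by (intro prod_mono) (auto intro!: qint_le_inverse)
  also have "\<dots> = 1 / ?Z" by (simp add: prod_dividef)
  finally have Z: "(1 - t) ^ n \<le> 1 / ?Z" .
  have "real ((n - 1) choose m) * t ^ m * (1 - t) ^ n \<le> real (card ?S) * t ^ m * (1 / ?Z)"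
    using Z assms binomial_le_card_inversions[of n m] by (intro mult_mono) auto
  also have "\<dots> = (\<Sum>\<sigma>\<in>?S. mallows n t \<sigma>)"
    by (simp add: mallows_def)
  also have "\<dots> = prob {\<omega> \<in> space \<Omega>. inversions n (X t \<omega>) = m}"
    by (rule mallows_process_prob[OF assms(1), symmetric])
  finally show ?thesis .
qed

text \<open>Serves to show that level \<open>k\<close> is reached almost surely. For
  \<open>t \<ge> 1\<close> the normalising constant is at least \<open>t ^ (n - 1)\<close>, one
  factor \<open>t\<close> for each index in \<open>{2..n}\<close>.\<close>

lemma prob_inversions_less_tendsto_0:
  assumes "k < n"
  shows "((\<lambda>t. prob {\<omega> \<in> space \<Omega>. inversions n (X t \<omega>) < k}) \<longlongrightarrow> 0) at_top"
proof (rule tendsto_sandwich[where f = "\<lambda>_. 0"])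
  let ?S = "{\<sigma>. \<sigma> permutes {1..n} \<and> inversions n \<sigma> < k}"
  show "((\<lambda>t. real (card ?S) / t) \<longlongrightarrow> 0) at_top"
    by (intro real_tendsto_divide_at_top[OF tendsto_const] filterlim_ident)
  show "\<forall>\<^sub>F t in at_top. prob {\<omega> \<in> space \<Omega>. inversions n (X t \<omega>) < k} \<le> real (card ?S) / t"
    using eventually_ge_at_top[of 1]
  proof eventually_elim
    case (elim t)
    have "t ^ (n - 1) = (\<Prod>j\<in>{2..n}. t)" by simp
    also have "\<dots> \<le> (\<Prod>j\<in>{2..n}. qint t j)"
    proof (rule prod_mono)
      fix j assume "j \<in> {2..n}"
      with qint_ge_1_plus[of t j] elim show "0 \<le> t \<and> t \<le> qint t j" by auto
    qed
    also have "\<dots> \<le> (\<Prod>j\<in>{1..n}. qint t j)"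
      using elim by (intro prod_mono2) (auto intro!: qint_ge_1 sum_nonneg)
    finally have Z: "t ^ (n - 1) \<le> (\<Prod>j=1..n. qint t j)" .
    have "prob {\<omega> \<in> space \<Omega>. inversions n (X t \<omega>) < k} = (\<Sum>\<sigma>\<in>?S. mallows n t \<sigma>)"
      using elim by (intro mallows_process_prob) auto
    also have "\<dots> \<le> (\<Sum>\<sigma>\<in>?S. 1 / t)"
    proof (rule sum_mono)
      fix \<sigma> assume "\<sigma> \<in> ?S"
      \<comment> \<open>Here \<open>k < n\<close> enters: it leaves one spare power of
        \<open>t\<close> in the denominator, hence the bound \<open>1 / t\<close> for each
        permutation.\<close>
      then have "Suc (inversions n \<sigma>) \<le> n - 1" using assms by auto
      then have "t * t ^ inversions n \<sigma> \<le> t ^ (n - 1)"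
        using elim by (subst power_Suc[symmetric]) (rule power_increasing)
      also note Z
      finally have "t * t ^ inversions n \<sigma> \<le> (\<Prod>j=1..n. qint t j)" .
      moreover have "0 < (\<Prod>j=1..n. qint t j)"
        using elim by (intro prod_pos ballI less_le_trans[OF zero_less_one qint_ge_1]) auto
      ultimately show "mallows n t \<sigma> \<le> 1 / t"
        using elim by (simp add: mallows_def field_simps)
    qed
    finally show ?case by simp
  qed
  show "\<forall>\<^sub>F t in at_top. 0 \<le> prob {\<omega> \<in> space \<Omega>. inversions n (X t \<omega>) < k}"
    by simp
qed (rule tendsto_const)

end

section \<open>Monotone paths: attained infima, measurability and distribution of the jump
  times\<close>

context
  fixes n :: nat and \<Omega> :: "'a measure" and X :: "real \<Rightarrow> 'a \<Rightarrow> nat \<Rightarrow> nat"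
  assumes prob: "prob_space \<Omega>" and monotone: "monotone_mallows_process n \<Omega> X"
begin

interpretation prob_space \<Omega> by (rule prob)

lemma mallows_process_if_monotone: "mallows_process n \<Omega> X"
  using monotone by (simp add: monotone_mallows_process_def)

lemma inversions_mono:
  "\<omega> \<in> space \<Omega> \<Longrightarrow> 0 \<le> s \<Longrightarrow> s \<le> t \<Longrightarrow> inversions n (X s \<omega>) \<le> inversions n (X t \<omega>)"
  using monotone by (cases "s = t") (auto simp: monotone_mallows_process_def)

text \<open>Limits in the product topology are coordinatewise and \<open>nat\<close> is discrete, so
  the finitely many coordinates entering \<open>inversions\<close> are eventually constant to the
  right of \<open>t\<close>. A single \<open>s\<close> is enough because monotonicity controls the
  times between \<open>t\<close> and \<open>s\<close>.\<close>

lemma inversions_right_continuous: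
  assumes "\<omega> \<in> space \<Omega>" "0 \<le> t"
  shows "\<exists>s>t. inversions n (X s \<omega>) = inversions n (X t \<omega>)"
proof -
  have lim: "((\<lambda>s. X s \<omega>) \<longlongrightarrow> X t \<omega>) (at_right t)"
    using mallows_process_if_monotone assms by (auto simp: mallows_process_def cadlag_def)
  have "\<forall>\<^sub>F s in at_right t. X s \<omega> i = X t \<omega> i" for i
  proof -
    have "continuous_on UNIV (\<lambda>\<sigma>. \<sigma> i :: nat)"
      by (rule continuous_on_product_coordinates)
    then have "((\<lambda>s. X s \<omega> i) \<longlongrightarrow> X t \<omega> i) (at_right t)"
      by (rule continuous_on_tendsto_compose[OF _ lim]) auto
    then show ?thesis
      by (simp add: tendsto_discrete)
  qed
  then have "\<forall>\<^sub>F s in at_right t. \<forall>i\<in>{1..n}. X s \<omega> i = X t \<omega> i"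
    by (intro eventually_ball_finite) auto
  moreover have "\<forall>\<^sub>F s in at_right t. s > t" by (rule eventually_at_right_less)
  ultimately have "\<forall>\<^sub>F s in at_right t. s > t \<and> (\<forall>i\<in>{1..n}. X s \<omega> i = X t \<omega> i)"
    by eventually_elim auto
  then obtain s where "s > t" and eq: "\<And>i. i \<in> {1..n} \<Longrightarrow> X s \<omega> i = X t \<omega> i"
    using eventually_happens'[OF trivial_limit_at_right_real] by blast
  moreover have "{(i, j). i \<in> {1..n} \<and> j \<in> {1..n} \<and> i < j \<and> X s \<omega> i > X s \<omega> j}
      = {(i, j). i \<in> {1..n} \<and> j \<in> {1..n} \<and> i < j \<and> X t \<omega> i > X t \<omega> j}"
    using eq by auto
  ultimately show ?thesis by (auto simp: inversions_def)
qed

text \<open>Right continuity makes the infimum attained. The time \<open>u\<close> only witnesses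
  that the set under the infimum is nonempty.\<close>

lemma jump_time_le_iff:
  assumes "\<omega> \<in> space \<Omega>" "0 \<le> u" "k \<le> inversions n (X u \<omega>)" "0 \<le> t"
  shows "jump_time n X k \<omega> \<le> t \<longleftrightarrow> k \<le> inversions n (X t \<omega>)"
proof
  let ?T = "{t. 0 \<le> t \<and> k \<le> inversions n (X t \<omega>)}"
  have bdd: "bdd_below ?T" by (rule bdd_belowI[of _ 0]) auto
  assume "k \<le> inversions n (X t \<omega>)"
  with assms show "jump_time n X k \<omega> \<le> t"
    unfolding jump_time_def by (intro cInf_lower bdd) auto
next
  let ?T = "{t. 0 \<le> t \<and> k \<le> inversions n (X t \<omega>)}"
  assume le: "jump_time n X k \<omega> \<le> t"
  obtain s where s: "s > t" "inversions n (X s \<omega>) = inversions n (X t \<omega>)"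
    using inversions_right_continuous assms by blast
  have "?T \<noteq> {}" using assms by auto
  moreover have "Inf ?T < s" using le s by (simp add: jump_time_def)
  ultimately have "\<exists>r\<in>?T. r < s" by (rule cInf_lessD)
  then obtain r where "r \<in> ?T" "r < s" ..
  then have "0 \<le> r" "r \<le> s" "k \<le> inversions n (X r \<omega>)" by auto
  then have "k \<le> inversions n (X s \<omega>)"
    using inversions_mono[OF assms(1), of r s] by linarith
  with s show "k \<le> inversions n (X t \<omega>)" by simp
qed

lemma jump_time_nonneg:
  assumes "\<omega> \<in> space \<Omega>" "0 \<le> u" "k \<le> inversions n (X u \<omega>)"
  shows "0 \<le> jump_time n X k \<omega>"
  unfolding jump_time_def using assms by (intro cInf_greatest) auto

text \<open>Where the level \<open>k\<close> is never reached, \<open>jump_time\<close> is the junk value \<open>Inf {}\<close>.\<close>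

definition never_reached :: "nat \<Rightarrow> 'a set" where
  "never_reached k = {\<omega> \<in> space \<Omega>. \<forall>u::nat. inversions n (X (real u) \<omega>) < k}"

text \<open>Integer times make \<open>never_reached\<close> a countable intersection of events;
  monotonicity carries the bound over to all real times.\<close>

lemma never_reachedD:
  assumes "\<omega> \<in> never_reached k" "0 \<le> u"
  shows "inversions n (X u \<omega>) < k"
proof -
  obtain N :: nat where "u \<le> real N" using real_arch_simple by blast
  with inversions_mono[of \<omega> u "real N"] assms show ?thesis
    by (auto simp: never_reached_def intro: le_less_trans)
qed

lemma sets_never_reached: "never_reached k \<in> sets \<Omega>"
proof -
  have "never_reached k = (\<Inter>u::nat. {\<omega> \<in> space \<Omega>. inversions n (X (real u) \<omega>) < k})"
    by (auto simp: never_reached_def)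
  also have "\<dots> \<in> sets \<Omega>"
    by (intro sets.countable_INT' image_subsetI mallows_process_pred_sets[OF prob mallows_process_if_monotone]) auto
  finally show ?thesis .
qed

lemma prob_never_reached:
  assumes "k < n"
  shows "prob (never_reached k) = 0"
proof -
  have "prob (never_reached k) \<le> 0"
  proof (rule tendsto_lowerbound[OF prob_inversions_less_tendsto_0[OF prob mallows_process_if_monotone assms]])
    show "\<forall>\<^sub>F t in at_top. prob (never_reached k) \<le> prob {\<omega> \<in> space \<Omega>. inversions n (X t \<omega>) < k}"
      using eventually_ge_at_top[of 0]
    proof eventually_elim
      case (elim t)
      have "never_reached k \<subseteq> {\<omega> \<in> space \<Omega>. inversions n (X t \<omega>) < k}"
        using never_reachedD elim by (auto simp: never_reached_def)
      then show ?case
        by (rule finite_measure_mono) (rule mallows_process_pred_sets[OF prob mallows_process_if_monotone elim])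
    qed
  qed simp
  then show ?thesis by (simp add: measure_le_0_iff)
qed

lemma jump_time_le_iff_of_reached:
  assumes "\<omega> \<in> space \<Omega> - never_reached k"
  shows "jump_time n X k \<omega> \<le> t \<longleftrightarrow> 0 \<le> t \<and> k \<le> inversions n (X t \<omega>)"
proof -
  obtain u :: nat where u: "k \<le> inversions n (X (real u) \<omega>)"
    using assms by (auto simp: never_reached_def not_less)
  show ?thesis
    using jump_time_le_iff[of \<omega> "real u" k t] jump_time_nonneg[of \<omega> "real u" k] u assms
    by (cases "0 \<le> t") auto
qed

text \<open>Covers all \<open>k\<close> and \<open>n\<close>, including unreachable levels: on
  \<open>never_reached k\<close> the function is the constant \<open>Inf {}\<close>, whatever its
  value. The weak convergence criterion for vectors asks for a probability law at every
  \<open>n\<close>, small ones included.\<close>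

lemma borel_measurable_jump_time: "jump_time n X k \<in> borel_measurable \<Omega>"
proof (subst borel_measurable_iff_le, rule allI)
  fix t
  have "{\<omega> \<in> space \<Omega>. 0 \<le> t \<and> k \<le> inversions n (X t \<omega>)} \<in> sets \<Omega>"
    using mallows_process_pred_sets[OF prob mallows_process_if_monotone, of t "\<lambda>\<sigma>. k \<le> inversions n \<sigma>"]
    by (cases "0 \<le> t") auto
  moreover have "{\<omega> \<in> space \<Omega>. jump_time n X k \<omega> \<le> t} =
      ({\<omega> \<in> space \<Omega>. 0 \<le> t \<and> k \<le> inversions n (X t \<omega>)} - never_reached k)
      \<union> (never_reached k \<inter> {\<omega> \<in> space \<Omega>. Inf {} \<le> t})"
  proof -
    have "jump_time n X k \<omega> = Inf {}" if "\<omega> \<in> never_reached k" for \<omega>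
      unfolding jump_time_def using never_reachedD[OF that]
      by (intro arg_cong[where f = Inf]) (blast dest: leD)
    moreover have "never_reached k \<subseteq> space \<Omega>" by (auto simp: never_reached_def)
    moreover have "jump_time n X k \<omega> \<le> t \<longleftrightarrow> 0 \<le> t \<and> k \<le> inversions n (X t \<omega>)"
      if "\<omega> \<in> space \<Omega>" "\<omega> \<notin> never_reached k" for \<omega>
      using jump_time_le_iff_of_reached[of \<omega> k t] that by blast
    ultimately show ?thesis
      by (intro set_eqI; case_tac "x \<in> never_reached k") auto
  qed
  moreover have "{\<omega> \<in> space \<Omega>. Inf {} \<le> t} \<in> sets \<Omega>"
    by simp
  ultimately show "{\<omega> \<in> space \<Omega>. jump_time n X k \<omega> \<le> t} \<in> sets \<Omega>"
    by (simp only: sets.Un sets.Diff sets.Int sets_never_reached)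
qed

text \<open>Nothing is assumed about \<open>X t\<close> at negative \<open>t\<close>, so these times
  are split off; there the event is null, as jump times are nonnegative once the level is
  reached.\<close>

lemma prob_jump_time_le:
  assumes "k < n"
  shows "prob {\<omega> \<in> space \<Omega>. jump_time n X k \<omega> \<le> t}
    = (if t < 0 then 0 else prob {\<omega> \<in> space \<Omega>. k \<le> inversions n (X t \<omega>)})"
proof -
  have "AE \<omega> in \<Omega>. \<omega> \<notin> never_reached k"
    using prob_never_reached[OF assms] sets_never_reached[of k]
    by (intro AE_not_in) (auto simp: null_sets_def emeasure_eq_measure)
  then have "AE \<omega> in \<Omega>. \<omega> \<in> {\<omega> \<in> space \<Omega>. jump_time n X k \<omega> \<le> t}
      \<longleftrightarrow> \<omega> \<in> {\<omega> \<in> space \<Omega>. 0 \<le> t \<and> k \<le> inversions n (X t \<omega>)}"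
    using AE_space by eventually_elim (use jump_time_le_iff_of_reached in blast)
  moreover have "{\<omega> \<in> space \<Omega>. jump_time n X k \<omega> \<le> t} \<in> sets \<Omega>"
    using borel_measurable_jump_time[of k] by measurable
  moreover have "{\<omega> \<in> space \<Omega>. 0 \<le> t \<and> k \<le> inversions n (X t \<omega>)} \<in> sets \<Omega>"
    using mallows_process_pred_sets[OF prob mallows_process_if_monotone, of t "\<lambda>\<sigma>. k \<le> inversions n \<sigma>"]
    by (cases "0 \<le> t") auto
  ultimately have "prob {\<omega> \<in> space \<Omega>. jump_time n X k \<omega> \<le> t}
      = prob {\<omega> \<in> space \<Omega>. 0 \<le> t \<and> k \<le> inversions n (X t \<omega>)}"
    by (rule finite_measure_eq_AE)
  then show ?thesis by auto
qed

end

section \<open>Convergence to the Gamma law\<close>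

text \<open>The upper bound at \<open>m\<close> comes from the lower bounds at the other points:
  \<open>q n m\<close> is at most 1 minus their sum over a finite window that carries almost all of
  the mass of \<open>p\<close>.\<close>

lemma tendsto_pmf_if_lower_bounds:
  fixes p :: "nat \<Rightarrow> real" and q l :: "nat \<Rightarrow> nat \<Rightarrow> real"
  assumes p: "p sums 1"
    and lp: "\<And>m. (\<lambda>n. l n m) \<longlonglongrightarrow> p m"
    and lq: "\<And>m. \<forall>\<^sub>F n in sequentially. l n m \<le> q n m"
    and q: "\<And>n A. finite A \<Longrightarrow> (\<Sum>m\<in>A. q n m) \<le> 1"
  shows "(\<lambda>n. q n m) \<longlonglongrightarrow> p m"
proof (rule order_tendstoI)
  fix a assume "a < p m"
  then have "\<forall>\<^sub>F n in sequentially. a < l n m"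
    by (rule order_tendstoD(1)[OF lp])
  with lq[of m] show "\<forall>\<^sub>F n in sequentially. a < q n m"
    by eventually_elim simp
next
  fix a assume "p m < a"
  have "(\<lambda>N. \<Sum>i<N. p i) \<longlonglongrightarrow> 1"
    using p by (simp add: sums_def)
  then have "\<forall>\<^sub>F N in sequentially. 1 - (a - p m) < (\<Sum>i<N. p i)"
    by (rule order_tendstoD(1)) (use \<open>p m < a\<close> in simp)
  then have "\<forall>\<^sub>F N in sequentially. 1 - (a - p m) < (\<Sum>i<N. p i) \<and> m < N"
    using eventually_gt_at_top[of m] by eventually_elim simp
  \<comment> \<open>The window \<open>{..<N}\<close> contains \<open>m\<close> and leaves less than
    \<open>a - p m\<close> of the mass of \<open>p\<close> outside.\<close>
  then obtain N where N: "1 - (a - p m) < (\<Sum>i<N. p i)" "m < N"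
    using eventually_happens'[OF sequentially_bot] by blast
  have "(\<lambda>n. 1 - (\<Sum>i\<in>{..<N} - {m}. l n i)) \<longlonglongrightarrow> 1 - (\<Sum>i\<in>{..<N} - {m}. p i)"
    by (intro tendsto_intros lp)
  moreover have "1 - (\<Sum>i\<in>{..<N} - {m}. p i) < a"
    using N by (subst sum_diff1) auto
  ultimately have "\<forall>\<^sub>F n in sequentially. 1 - (\<Sum>i\<in>{..<N} - {m}. l n i) < a"
    by (rule order_tendstoD(2))
  moreover have "\<forall>\<^sub>F n in sequentially. \<forall>i\<in>{..<N}. l n i \<le> q n i"
    by (intro eventually_ball_finite ballI lq) auto
  ultimately show "\<forall>\<^sub>F n in sequentially. q n m < a"
  proof eventually_elim
    case (elim n)
    have "q n m + (\<Sum>i\<in>{..<N} - {m}. q n i) = (\<Sum>i\<in>{..<N}. q n i)"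
      using N(2) by (intro sum.remove[symmetric]) auto
    also have "\<dots> \<le> 1" by (rule q) simp
    finally have "q n m \<le> 1 - (\<Sum>i\<in>{..<N} - {m}. q n i)" by simp
    also have "\<dots> \<le> 1 - (\<Sum>i\<in>{..<N} - {m}. l n i)"
      using elim(2) by (intro diff_left_mono sum_mono) auto
    finally show ?case using elim(1) by simp
  qed
qed

section \<open>Poisson limit of the number of inversions at time \<open>x / n\<close>\<close>

lemma tendsto_one_minus_power: "(\<lambda>n. (1 - x / real n) ^ n) \<longlonglongrightarrow> exp (- x)"
  using tendsto_exp_limit_sequentially[of "- x"] by simp

lemma tendsto_diff_const_over_n: "(\<lambda>n. (real n - c) / real n) \<longlonglongrightarrow> 1"
  by real_asymp

lemma tendsto_binomial_poisson:
  "(\<lambda>n. real ((n - 1) choose m) * (x / real n) ^ m * (1 - x / real n) ^ n)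
    \<longlonglongrightarrow> exp (- x) * x ^ m / fact m"
proof -
  \<comment> \<open>The binomial coefficient is the product of \<open>n - 1, ..., n - m\<close> over
    \<open>fact m\<close>; each of the \<open>m\<close> factors is paired with one \<open>n\<close>
    from the denominator of \<open>(x / n) ^ m\<close>.\<close>
  have "(\<lambda>n. (\<Prod>i<m. (real n - (1 + real i)) / real n) * (x ^ m / fact m) * (1 - x / real n) ^ n)
      \<longlonglongrightarrow> (\<Prod>i<m. 1) * (x ^ m / fact m) * exp (- x)"
    by (intro tendsto_mult tendsto_prod tendsto_const tendsto_one_minus_power tendsto_diff_const_over_n)
  moreover have "\<forall>\<^sub>F n in sequentially.
      (\<Prod>i<m. (real n - (1 + real i)) / real n) * (x ^ m / fact m) * (1 - x / real n) ^ n
      = real ((n - 1) choose m) * (x / real n) ^ m * (1 - x / real n) ^ n"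
    using eventually_ge_at_top[of 1]
  proof eventually_elim
    case (elim n)
    have "real ((n - 1) choose m) = (\<Prod>i<m. real n - (1 + real i)) / fact m"
      using elim by (simp add: binomial_gbinomial gbinomial_prod_rev atLeast0LessThan of_nat_diff algebra_simps)
    then show ?case
      by (simp add: prod_dividef power_divide)
  qed
  ultimately have "(\<lambda>n. real ((n - 1) choose m) * (x / real n) ^ m * (1 - x / real n) ^ n)
      \<longlonglongrightarrow> (\<Prod>i<m. 1) * (x ^ m / fact m) * exp (- x)"
    by (rule Lim_transform_eventually)
  then show ?thesis by (simp add: mult_ac)
qed

lemma tendsto_prob_inversions:
  fixes \<Omega> :: "nat \<Rightarrow> 'a measure"
  assumes prob: "\<And>n. prob_space (\<Omega> n)"
    and mallows: "\<And>n. mallows_process n (\<Omega> n) (M n)" and "0 \<le> x"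
  shows "(\<lambda>n. measure (\<Omega> n) {\<omega> \<in> space (\<Omega> n). inversions n (M n (x / real n) \<omega>) = m})
    \<longlonglongrightarrow> exp (- x) * x ^ m / fact m"
proof (rule tendsto_pmf_if_lower_bounds[where p = "\<lambda>m. exp (- x) * x ^ m / fact m"])
  show "(\<lambda>m. exp (- x) * x ^ m / fact m) sums 1"
    using sums_mult[OF exp_converges[of x], of "exp (- x)"] by (simp add: exp_minus divide_inverse mult_ac)
  show "(\<lambda>n. real ((n - 1) choose m) * (x / real n) ^ m * (1 - x / real n) ^ n)
    \<longlonglongrightarrow> exp (- x) * x ^ m / fact m" for m
    by (rule tendsto_binomial_poisson)
  have "\<forall>\<^sub>F n in sequentially. x < real n"
    using filterlim_real_sequentially by (simp add: filterlim_at_top_dense)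
  then show "\<forall>\<^sub>F n in sequentially. real ((n - 1) choose m) * (x / real n) ^ m * (1 - x / real n) ^ n
    \<le> measure (\<Omega> n) {\<omega> \<in> space (\<Omega> n). inversions n (M n (x / real n) \<omega>) = m}" for m
  proof eventually_elim
    case (elim n)
    then show ?case
      using \<open>0 \<le> x\<close> by (intro prob_inversions_lower_bound prob mallows) auto
  qed
  \<comment> \<open>Required at every \<open>n\<close>; at \<open>n = 0\<close> the time
    \<open>x / real n\<close> is 0 and still admissible.\<close>
  show "(\<Sum>m\<in>A. measure (\<Omega> n) {\<omega> \<in> space (\<Omega> n). inversions n (M n (x / real n) \<omega>) = m}) \<le> 1"
    if "finite A" for n A
  proof -
    interpret prob_space "\<Omega> n" by (rule prob)
    have "(\<Sum>m\<in>A. prob {\<omega> \<in> space (\<Omega> n). inversions n (M n (x / real n) \<omega>) = m})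
        = prob (\<Union>m\<in>A. {\<omega> \<in> space (\<Omega> n). inversions n (M n (x / real n) \<omega>) = m})"
      using \<open>0 \<le> x\<close>
      by (intro finite_measure_finite_Union[symmetric] that)
        (auto simp: disjoint_family_on_def intro!: mallows_process_pred_sets[OF prob mallows])
    then show ?thesis by simp
  qed
qed

text \<open>Poisson-Gamma duality: the Erlang distribution function at \<open>x\<close> is the
  probability that a Poisson variable of mean \<open>x\<close> is at least \<open>k\<close>. The
  distribution functions converge at every real \<open>x\<close>.\<close>

lemma weak_conv_jump_time_gamma:
  fixes \<Omega> :: "nat \<Rightarrow> 'a measure"
  assumes prob: "\<And>n. prob_space (\<Omega> n)"
    and mono: "\<And>n. monotone_mallows_process n (\<Omega> n) (M n)" and "k \<ge> 1"
  shows "weak_conv_m (\<lambda>n. distr (\<Omega> n) borel (\<lambda>\<omega>. real n * jump_time n (M n) k \<omega>)) (gamma_law k)"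
  unfolding weak_conv_m_def weak_conv_def
proof (intro allI impI)
  fix x
  let ?P = "\<lambda>n m. measure (\<Omega> n) {\<omega> \<in> space (\<Omega> n). inversions n (M n (x / real n) \<omega>) = m}"
  let ?F = "\<lambda>n. if x < 0 then 0 else 1 - (\<Sum>m<k. ?P n m)"
  have gamma: "cdf (gamma_law k) x = erlang_CDF (k - 1) 1 x"
    by (simp add: cdf_def gamma_law_def measure_def emeasure_erlang_density)
  have "?F \<longlonglongrightarrow> erlang_CDF (k - 1) 1 x"
  proof (cases "x < 0")
    case False
    then have "(\<lambda>n. 1 - (\<Sum>m<k. ?P n m)) \<longlonglongrightarrow> 1 - (\<Sum>m<k. exp (- x) * x ^ m / fact m)"
      using mono by (intro tendsto_intros tendsto_prob_inversions prob)
        (auto simp: monotone_mallows_process_def)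
    \<comment> \<open>The Erlang index is one less than the number of exponential summands;
      \<open>k \<ge> 1\<close> makes the truncated subtraction exact.\<close>
    moreover have "{..k - 1} = {..<k}" using \<open>k \<ge> 1\<close> by auto
    ultimately show ?thesis using False by (simp add: erlang_CDF_def mult_ac)
  qed (simp add: erlang_CDF_def)
  moreover have "\<forall>\<^sub>F n in sequentially.
      ?F n = cdf (distr (\<Omega> n) borel (\<lambda>\<omega>. real n * jump_time n (M n) k \<omega>)) x"
    using eventually_gt_at_top[of k]
  proof eventually_elim
    case (elim n)
    interpret prob_space "\<Omega> n" by (rule prob)
    have mallows: "mallows_process n (\<Omega> n) (M n)"
      using mono by (simp add: monotone_mallows_process_def)
    have [measurable]: "jump_time n (M n) k \<in> borel_measurable (\<Omega> n)"
      by (rule borel_measurable_jump_time[OF prob mono])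
    have "cdf (distr (\<Omega> n) borel (\<lambda>\<omega>. real n * jump_time n (M n) k \<omega>)) x
        = prob {\<omega> \<in> space (\<Omega> n). real n * jump_time n (M n) k \<omega> \<le> x}"
      by (simp add: cdf_def measure_distr vimage_def Int_def conj_commute)
    also have "\<dots> = prob {\<omega> \<in> space (\<Omega> n). jump_time n (M n) k \<omega> \<le> x / real n}"
      using elim by (simp add: field_simps)
    also have "\<dots> = (if x < 0 then 0 else prob {\<omega> \<in> space (\<Omega> n). k \<le> inversions n (M n (x / real n) \<omega>)})"
      using elim by (subst prob_jump_time_le[OF prob mono]) (auto simp: field_simps)
    also have "\<dots> = ?F n"
    proof (cases "x < 0")
      case False
      then have sets: "{\<omega> \<in> space (\<Omega> n). Q (M n (x / real n) \<omega>)} \<in> events" for Q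
        by (intro mallows_process_pred_sets[OF prob mallows]) auto
      have "(\<Sum>m<k. ?P n m) = prob (\<Union>m<k. {\<omega> \<in> space (\<Omega> n). inversions n (M n (x / real n) \<omega>) = m})"
        using sets by (intro finite_measure_finite_Union[symmetric]) (auto simp: disjoint_family_on_def)
      also have "(\<Union>m<k. {\<omega> \<in> space (\<Omega> n). inversions n (M n (x / real n) \<omega>) = m})
          = space (\<Omega> n) - {\<omega> \<in> space (\<Omega> n). k \<le> inversions n (M n (x / real n) \<omega>)}"
        by auto
      also have "prob \<dots> = 1 - prob {\<omega> \<in> space (\<Omega> n). k \<le> inversions n (M n (x / real n) \<omega>)}"
        by (rule prob_compl) (rule sets)
      finally show ?thesis using False by simp
    qed simp
    finally show ?case ..
  qed
  ultimately show "(\<lambda>n. cdf (distr (\<Omega> n) borel (\<lambda>\<omega>. real n * jump_time n (M n) k \<omega>)) x)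
      \<longlonglongrightarrow> cdf (gamma_law k) x"
    unfolding gamma by (rule Lim_transform_eventually)
qed

section \<open>Weak convergence from lower bounds on grid cells\<close>

text \<open>Open on the left and closed on the right, to match events of the form
  \<open>a < T\<close> and \<open>T \<le> b\<close>, which are decided by the path at the times
  \<open>a\<close> and \<open>b\<close>. The zero coordinates follow the encoding of
  \<open>k\<close>-vectors.\<close>

definition grid_cell :: "nat \<Rightarrow> nat \<Rightarrow> (nat \<Rightarrow> nat) \<Rightarrow> (nat \<Rightarrow> real) set" where
  "grid_cell k m c = {y. (\<forall>i<k. real (c i) / real m < y i \<and> y i \<le> (real (c i) + 1) / real m) \<and> (\<forall>i\<ge>k. y i = 0)}"

text \<open>Strictly increasing indices put the points into different intervals. The cells left out,
  where points share an interval, lose no mass in the limit: a strictly increasing positive vector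
  avoids them once the mesh is fine.\<close>

definition grid_index :: "nat \<Rightarrow> nat \<Rightarrow> (nat \<Rightarrow> nat) set" where
  "grid_index k N = {c \<in> {..<k} \<rightarrow>\<^sub>E {..<N}. strict_mono_on {..<k} c}"

lemma finite_grid_index: "finite (grid_index k N)"
  unfolding grid_index_def by (simp add: finite_PiE)

lemma borel_measurable_coordinate [measurable]: "(\<lambda>y::nat \<Rightarrow> real. y i) \<in> borel_measurable borel"
  by (intro borel_measurable_continuous_onI continuous_on_product_coordinates)

lemma grid_cell_in_borel [measurable]: "grid_cell k m c \<in> sets borel"
proof -
  have "{y \<in> space borel. (\<forall>i<k. real (c i) / real m < y i \<and> y i \<le> (real (c i) + 1) / real m) \<and> (\<forall>i\<ge>k. y i = 0)}
    \<in> sets (borel :: (nat \<Rightarrow> real) measure)"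
    by measurable
  then show ?thesis by (simp add: grid_cell_def)
qed

lemma grid_cell_unique:
  assumes "0 < m" "y \<in> grid_cell k m c" "y \<in> grid_cell k m c'" "c \<in> grid_index k N" "c' \<in> grid_index k N"
  shows "c = c'"
proof
  fix i show "c i = c' i"
  proof (cases "i < k")
    case True
    then have "real (c i) < real (c' i) + 1" "real (c' i) < real (c i) + 1"
      using assms(1-3) by (auto simp: grid_cell_def field_simps dest!: spec[of _ i])
    then show ?thesis by linarith
  next
    case False
    then show ?thesis using assms(4,5) by (auto simp: grid_index_def PiE_def extensional_def)
  qed
qed

section \<open>Approximation of a nonnegative continuous function from below by step functions on
  cells\<close>

lemma tendsto_pointwise:
  fixes z :: "'b \<Rightarrow> 'i \<Rightarrow> 'c::topological_space"
  assumes "\<And>i. ((\<lambda>n. z n i) \<longlongrightarrow> y i) F"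
  shows "(z \<longlongrightarrow> y) F"
proof -
  have "limitin (product_topology (\<lambda>i. euclidean) UNIV) z y F"
    using assms by (simp add: limitin_componentwise limitin_canonical_iff)
  then show ?thesis
    by (simp add: euclidean_product_topology limitin_canonical_iff)
qed

text \<open>A lower Darboux step function. With \<open>m * m\<close> intervals of length
  \<open>1 / m\<close> per axis it covers coordinates in \<open>{0<..m}\<close>, so one parameter
  both refines the mesh and enlarges the range.\<close>

definition lower_step :: "nat \<Rightarrow> ((nat \<Rightarrow> real) \<Rightarrow> real) \<Rightarrow> nat \<Rightarrow> (nat \<Rightarrow> real) \<Rightarrow> real" where
  "lower_step k f m y = (\<Sum>c\<in>grid_index k (m * m). Inf (f ` grid_cell k m c) * indicator (grid_cell k m c) y)"

lemma lower_step_eq: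
  assumes "0 < m" "c \<in> grid_index k (m * m)" "y \<in> grid_cell k m c"
  shows "lower_step k f m y = Inf (f ` grid_cell k m c)"
proof -
  have "lower_step k f m y = (\<Sum>c'\<in>grid_index k (m * m). if c' = c then Inf (f ` grid_cell k m c) else 0)"
    unfolding lower_step_def using grid_cell_unique[OF assms(1) _ assms(3) _ assms(2)] assms(3)
    by (intro sum.cong refl) (auto simp: indicator_def)
  then show ?thesis using assms(2) by (simp add: finite_grid_index)
qed

lemma lower_step_eq_0:
  assumes "\<And>c. c \<in> grid_index k (m * m) \<Longrightarrow> y \<notin> grid_cell k m c"
  shows "lower_step k f m y = 0"
  unfolding lower_step_def using assms by (intro sum.neutral) auto

lemma lower_step_le:
  assumes "0 < m" "\<And>y. 0 \<le> f y"
  shows "lower_step k f m y \<le> f y"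
proof (cases "\<exists>c\<in>grid_index k (m * m). y \<in> grid_cell k m c")
  case True
  then obtain c where c: "c \<in> grid_index k (m * m)" "y \<in> grid_cell k m c" by blast
  have "bdd_below (f ` grid_cell k m c)"
    using assms(2) by (intro bdd_belowI[of _ 0]) auto
  then show ?thesis
    using lower_step_eq[OF assms(1) c] c by (auto intro: cInf_lower)
next
  case False
  then show ?thesis using lower_step_eq_0[of k m y f] assms(2) by auto
qed

lemma Inf_image_grid_cell_nonneg:
  fixes f :: "(nat \<Rightarrow> real) \<Rightarrow> real"
  assumes "0 < m" "\<And>y. 0 \<le> f y"
  shows "0 \<le> Inf (f ` grid_cell k m c)"
proof -
  have "(\<lambda>i. if i < k then (real (c i) + 1) / real m else 0) \<in> grid_cell k m c"
    using assms(1) by (auto simp: grid_cell_def divide_strict_right_mono)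
  then have "f ` grid_cell k m c \<noteq> {}" by blast
  then show ?thesis
    using assms(2) by (intro cInf_greatest) auto
qed

lemma lower_step_nonneg:
  assumes "0 < m" "\<And>y. 0 \<le> f y"
  shows "0 \<le> lower_step k f m y"
  unfolding lower_step_def
  by (intro sum_nonneg mult_nonneg_nonneg Inf_image_grid_cell_nonneg assms) auto

lemma ex_grid_cell:
  assumes "0 < m" and pos: "\<And>i. i < k \<Longrightarrow> 0 < y i"
    and zero: "\<And>i. i \<ge> k \<Longrightarrow> y i = 0"
    and sep: "\<And>i j. i < j \<Longrightarrow> j < k \<Longrightarrow> 1 / real m < y j - y i"
    and le: "\<And>i. i < k \<Longrightarrow> y i \<le> real m"
  shows "\<exists>c\<in>grid_index k (m * m). y \<in> grid_cell k m c"
proof -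
  \<comment> \<open>Ceiling minus one rather than floor, since the cells contain their right end.
    Positivity of \<open>y i\<close> makes the integer nonnegative before \<open>nat\<close> is
    applied.\<close>
  let ?c = "\<lambda>i\<in>{..<k}. nat (\<lceil>real m * y i\<rceil> - 1)"
  have c: "real (?c i) < real m * y i \<and> real m * y i \<le> real (?c i) + 1" if "i < k" for i
  proof -
    have "0 < real m * y i" using assms(1) pos that by simp
    then have "1 \<le> \<lceil>real m * y i\<rceil>" by (simp add: less_ceiling_iff flip: zle_diff1_eq)
    then have "real (?c i) = of_int \<lceil>real m * y i\<rceil> - 1" using that by simp
    then show ?thesis by linarith
  qed
  have "?c i < m * m" if "i < k" for i
  proof -
    have "real m * y i \<le> real m * real m"
      using le[OF that] by (intro mult_left_mono) auto
    with c[OF that] have "real (?c i) < real (m * m)" by simp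
    then show ?thesis by (simp only: of_nat_less_iff)
  qed
  moreover have "?c i < ?c j" if "i < j" "j < k" for i j
  proof -
    have "real m * (1 / real m) < real m * (y j - y i)"
      using sep[OF that] assms(1) by (intro mult_strict_left_mono) auto
    then have "real m * y i + 1 < real m * y j"
      using assms(1) by (simp add: algebra_simps)
    with c[of i] c[of j] that have "real (?c i) < real (?c j)" by linarith
    then show ?thesis by (simp only: of_nat_less_iff)
  qed
  ultimately have "?c \<in> grid_index k (m * m)"
    by (auto simp: grid_index_def strict_mono_on_def)
  moreover have "y \<in> grid_cell k m ?c"
    using c zero assms(1) by (auto simp: grid_cell_def field_simps)
  ultimately show ?thesis by blast
qed

text \<open>No uniform continuity is involved: a near-minimiser \<open>z m\<close> of
  \<open>f\<close> in the cell of \<open>y\<close> is within \<open>1 / m\<close> of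
  \<open>y\<close> in each coordinate, so \<open>z m\<close> tends to \<open>y\<close> in the
  product topology, and \<open>lower_step\<close> is squeezed between \<open>f (z m) - 1 / m\<close>
  and \<open>f y\<close>.\<close>

lemma lower_step_tendsto:
  fixes f :: "(nat \<Rightarrow> real) \<Rightarrow> real"
  assumes f: "continuous_on UNIV f" "\<And>y. 0 \<le> f y"
    and pos: "\<And>i. i < k \<Longrightarrow> 0 < y i"
    and mono: "\<And>i j. i < j \<Longrightarrow> j < k \<Longrightarrow> y i < y j"
    and zero: "\<And>i. i \<ge> k \<Longrightarrow> y i = 0"
  shows "(\<lambda>m. lower_step k f m y) \<longlonglongrightarrow> f y"
proof -
  have inv: "(\<lambda>m. 1 / real m) \<longlonglongrightarrow> 0" by real_asymp
  have "\<forall>\<^sub>F m in sequentially. \<forall>i\<in>{..<k}. y i \<le> real m"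
    using filterlim_real_sequentially by (intro eventually_ball_finite) (auto simp: filterlim_at_top)
  moreover have "\<forall>\<^sub>F m in sequentially. \<forall>(i, j)\<in>{(i, j). i < j \<and> j < k}. 1 / real m < y j - y i"
  proof (intro eventually_ball_finite ballI)
    show "finite {(i, j). i < j \<and> j < k}"
      by (rule finite_subset[of _ "{..<k} \<times> {..<k}"]) auto
    fix p assume "p \<in> {(i, j). i < j \<and> j < k}"
    then show "\<forall>\<^sub>F m in sequentially. case p of (i, j) \<Rightarrow> 1 / real m < y j - y i"
      using order_tendstoD(2)[OF inv] mono by auto
  qed
  ultimately have "\<forall>\<^sub>F m in sequentially. 0 < m \<and> (\<exists>c\<in>grid_index k (m * m). y \<in> grid_cell k m c)"
    using eventually_gt_at_top[of 0]
  proof eventually_elim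
    case (elim m)
    then show ?case using pos zero by (intro conjI ex_grid_cell) auto
  qed
  moreover have "\<exists>z. f z < lower_step k f m y + 1 / real m \<and> (\<forall>i. \<bar>z i - y i\<bar> \<le> 1 / real m)"
    if m: "0 < m" and "\<exists>c\<in>grid_index k (m * m). y \<in> grid_cell k m c" for m
  proof -
    obtain c where c: "c \<in> grid_index k (m * m)" "y \<in> grid_cell k m c"
      using \<open>\<exists>c\<in>_. _\<close> by blast
    have "Inf (f ` grid_cell k m c) < lower_step k f m y + 1 / real m"
      using m lower_step_eq[OF m c, of f] by simp
    then obtain z where z: "z \<in> grid_cell k m c" "f z < lower_step k f m y + 1 / real m"
      using c(2) cInf_lessD[of "f ` grid_cell k m c"] by blast
    have "\<bar>z i - y i\<bar> \<le> 1 / real m" for i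
    proof (cases "i < k")
      case True
      with z(1) c(2) have "real (c i) / real m < z i" "z i \<le> real (c i) / real m + 1 / real m"
        "real (c i) / real m < y i" "y i \<le> real (c i) / real m + 1 / real m"
        by (auto simp: grid_cell_def add_divide_distrib)
      then show ?thesis by linarith
    next
      case False
      with z(1) c(2) show ?thesis by (simp add: grid_cell_def)
    qed
    with z(2) show ?thesis by blast
  qed
  ultimately have ex: "\<forall>\<^sub>F m in sequentially.
      0 < m \<and> (\<exists>z. f z < lower_step k f m y + 1 / real m \<and> (\<forall>i. \<bar>z i - y i\<bar> \<le> 1 / real m))"
    by (elim eventually_mono) blast
  define z where
    "z m = (SOME z. f z < lower_step k f m y + 1 / real m \<and> (\<forall>i. \<bar>z i - y i\<bar> \<le> 1 / real m))" for m
  from ex have z: "\<forall>\<^sub>F m in sequentially.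
      0 < m \<and> f (z m) < lower_step k f m y + 1 / real m \<and> (\<forall>i. \<bar>z m i - y i\<bar> \<le> 1 / real m)"
  proof eventually_elim
    case (elim m)
    from someI_ex[OF conjunct2[OF elim]] elim show ?case by (simp add: z_def)
  qed
  have "(\<lambda>m. z m i) \<longlonglongrightarrow> y i" for i
  proof -
    have "(\<lambda>m. z m i - y i) \<longlonglongrightarrow> 0"
      by (rule tendsto_rabs_zero_cancel, rule tendsto_sandwich[OF _ _ tendsto_const inv])
        (use z in \<open>auto elim: eventually_mono\<close>)
    then show ?thesis by (rule LIM_zero_cancel)
  qed
  then have "z \<longlonglongrightarrow> y" by (rule tendsto_pointwise)
  then have "(\<lambda>m. f (z m)) \<longlonglongrightarrow> f y"
    by (intro continuous_on_tendsto_compose[OF f(1)]) auto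
  then have lower: "(\<lambda>m. f (z m) - 1 / real m) \<longlonglongrightarrow> f y"
    using tendsto_diff[OF _ inv] by fastforce
  show ?thesis
    by (rule tendsto_sandwich[OF _ _ lower tendsto_const])
      (use z lower_step_le[of _ f] f(2) in \<open>auto elim!: eventually_mono\<close>)
qed

text \<open>The mesh is fixed first, fine enough that the step function and the factor
  \<open>exp (- 1 / real m)\<close> together cost at most \<open>e / 2\<close>; then only finitely
  many cells remain and \<open>n\<close> can be taken large for all of them at once.\<close>

lemma liminf_integral_ge:
  fixes f :: "(nat \<Rightarrow> real) \<Rightarrow> real"
  assumes P: "\<And>n. prob_space (P n)" "\<And>n. sets (P n) = sets borel"
    and L: "prob_space L" "sets L = sets borel"
    and AE: "AE y in L. (\<forall>i<k. 0 < y i) \<and> (\<forall>j<k. \<forall>i<j. y i < y j) \<and> (\<forall>i\<ge>k. y i = 0)"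
    and cells: "\<And>m c e. 0 < m \<Longrightarrow> strict_mono_on {..<k} c \<Longrightarrow> 0 < e \<Longrightarrow>
      \<forall>\<^sub>F n in sequentially. exp (- 1 / real m) * measure L (grid_cell k m c) - e \<le> measure (P n) (grid_cell k m c)"
    and f: "continuous_on UNIV f" "\<And>y. 0 \<le> f y" "\<And>y. f y \<le> B" and "0 < e"
  shows "\<forall>\<^sub>F n in sequentially. integral\<^sup>L L f - e < integral\<^sup>L (P n) f"
proof -
  interpret L: prob_space L by (rule L)
  interpret P: prob_space "P n" for n by (rule P)
  have meas: "f \<in> borel_measurable borel"
    by (rule borel_measurable_continuous_onI[OF f(1)])
  have step_meas: "lower_step k f m \<in> borel_measurable borel" for m
    unfolding lower_step_def by measurable
  have space: "space L = UNIV" "\<And>n. space (P n) = UNIV"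
    using sets_eq_imp_space_eq[OF L(2)] sets_eq_imp_space_eq[OF P(2)] by simp_all
  have mL: "f \<in> borel_measurable L" "lower_step k f m \<in> borel_measurable L" for m
    using meas step_meas by (simp_all add: measurable_cong_sets[OF L(2) refl])
  have mP: "f \<in> borel_measurable (P n)" "lower_step k f m \<in> borel_measurable (P n)" for m n
    using meas step_meas by (simp_all add: measurable_cong_sets[OF P(2) refl])
  let ?I = "\<lambda>m c. Inf (f ` grid_cell k m c)"
  \<comment> \<open>\<open>Suc m\<close> avoids the degenerate mesh at \<open>m = 0\<close>; the
    constant \<open>B\<close> dominates because the step functions lie between 0 and
    \<open>f\<close>.\<close>
  have "(\<lambda>m. integral\<^sup>L L (lower_step k f (Suc m))) \<longlonglongrightarrow> integral\<^sup>L L f"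
  proof (rule integral_dominated_convergence[where w = "\<lambda>_. B"])
    show "AE y in L. (\<lambda>m. lower_step k f (Suc m) y) \<longlonglongrightarrow> f y"
      using AE by eventually_elim (rule LIMSEQ_Suc, rule lower_step_tendsto, use f in auto)
    show "AE y in L. norm (lower_step k f (Suc m) y) \<le> B" for m
    proof (rule AE_I2)
      fix y
      show "norm (lower_step k f (Suc m) y) \<le> B"
        using lower_step_nonneg[of "Suc m" f k y] lower_step_le[of "Suc m" f k y] f(2) f(3)[of y] by simp
    qed
  qed (use mL in auto)
  moreover have "(\<lambda>m. exp (- 1 / real (Suc m))) \<longlonglongrightarrow> 1"
    by real_asymp
  ultimately have "(\<lambda>m. exp (- 1 / real (Suc m)) * integral\<^sup>L L (lower_step k f (Suc m))) \<longlonglongrightarrow> 1 * integral\<^sup>L L f"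
    by (intro tendsto_mult)
  then have "\<forall>\<^sub>F m in sequentially. integral\<^sup>L L f - e / 2 < exp (- 1 / real (Suc m)) * integral\<^sup>L L (lower_step k f (Suc m))"
    by (rule order_tendstoD) (use \<open>0 < e\<close> in simp)
  then obtain m' where "integral\<^sup>L L f - e / 2 < exp (- 1 / real (Suc m')) * integral\<^sup>L L (lower_step k f (Suc m'))"
    using eventually_happens'[OF sequentially_bot] by blast
  then obtain m where m: "0 < m" "integral\<^sup>L L f - e / 2 < exp (- 1 / real m) * integral\<^sup>L L (lower_step k f m)"
    by blast
  have I: "0 \<le> ?I m c" for c
    by (rule Inf_image_grid_cell_nonneg[OF m(1) f(2)])
  have cellL: "grid_cell k m c \<in> sets L" for c using L(2) by simp
  have cellP: "grid_cell k m c \<in> sets (P n)" for c n using P(2) by simp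
  have intL: "integral\<^sup>L L (lower_step k f m) = (\<Sum>c\<in>grid_index k (m * m). ?I m c * measure L (grid_cell k m c))"
    unfolding lower_step_def using cellL space
    by (subst Bochner_Integration.integral_sum) (auto simp: L.emeasure_eq_measure)
  have intP: "integral\<^sup>L (P n) (lower_step k f m) = (\<Sum>c\<in>grid_index k (m * m). ?I m c * measure (P n) (grid_cell k m c))" for n
    unfolding lower_step_def using cellP space
    by (subst Bochner_Integration.integral_sum) (auto simp: P.emeasure_eq_measure)
  define S where "S = (\<Sum>c\<in>grid_index k (m * m). ?I m c)"
  have S: "0 \<le> S" unfolding S_def by (intro sum_nonneg I)
  \<comment> \<open>The error allowed per cell: weighted by the infima, whose sum is
    \<open>S\<close>, the errors add up to at most \<open>e / 2\<close>. The \<open>+ 1\<close>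
    keeps the denominator positive when \<open>S = 0\<close>.\<close>
  define d where "d = e / (2 * (S + 1))"
  have d: "0 < d" using S \<open>0 < e\<close> by (simp add: d_def)
  have dS: "d * S \<le> e / 2"
    using S \<open>0 < e\<close> by (simp add: d_def field_simps)
  have "\<forall>\<^sub>F n in sequentially. \<forall>c\<in>grid_index k (m * m).
      exp (- 1 / real m) * measure L (grid_cell k m c) - d \<le> measure (P n) (grid_cell k m c)"
    by (intro eventually_ball_finite finite_grid_index ballI cells m(1) d) (simp add: grid_index_def)
  then show ?thesis
  proof eventually_elim
    case (elim n)
    have "exp (- 1 / real m) * integral\<^sup>L L (lower_step k f m) - d * S
      = (\<Sum>c\<in>grid_index k (m * m). ?I m c * (exp (- 1 / real m) * measure L (grid_cell k m c) - d))"
      by (simp add: intL S_def sum_distrib_left right_diff_distrib sum_subtractf mult_ac)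
    also have "\<dots> \<le> integral\<^sup>L (P n) (lower_step k f m)"
      unfolding intP using elim by (intro sum_mono mult_left_mono I) auto
    also have "\<dots> \<le> integral\<^sup>L (P n) f"
    proof (rule integral_mono)
      show "integrable (P n) f"
        by (rule P.integrable_const_bound[where B = B]) (use f mP in auto)
      show "integrable (P n) (lower_step k f m)"
      proof (rule P.integrable_const_bound[where B = B], rule AE_I2)
        fix y
        show "norm (lower_step k f m y) \<le> B"
          using lower_step_nonneg[of m f k y] lower_step_le[of m f k y] m(1) f(2) f(3)[of y] by simp
      qed (rule mP)
      show "lower_step k f m y \<le> f y" for y
        by (rule lower_step_le[OF m(1) f(2)])
    qed
    finally show ?case using m(2) dS by linarith
  qed
qed

text \<open>Lower bounds on cells suffice: applied to \<open>f + B\<close> and to \<open>B - f\<close> they pin down the limit,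
  since all total masses are 1.\<close>

lemma weak_conv_top_if_grid_cells:
  assumes P: "\<And>n. prob_space (P n)" "\<And>n. sets (P n) = sets borel"
    and L: "prob_space L" "sets L = sets borel"
    and AE: "AE y in L. (\<forall>i<k. 0 < y i) \<and> (\<forall>j<k. \<forall>i<j. y i < y j) \<and> (\<forall>i\<ge>k. y i = 0)"
    and cells: "\<And>m c e. 0 < m \<Longrightarrow> strict_mono_on {..<k} c \<Longrightarrow> 0 < e \<Longrightarrow>
      \<forall>\<^sub>F n in sequentially. exp (- 1 / real m) * measure L (grid_cell k m c) - e \<le> measure (P n) (grid_cell k m c)"
  shows "weak_conv_top P L"
  unfolding weak_conv_top_def
proof (intro allI impI)
  fix f :: "(nat \<Rightarrow> real) \<Rightarrow> real"
  assume f: "continuous_on UNIV f \<and> bounded (range f)"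
  then obtain B where B: "\<And>y. \<bar>f y\<bar> \<le> B" by (auto simp: bounded_iff)
  interpret L: prob_space L by (rule L)
  interpret P: prob_space "P n" for n by (rule P)
  have meas: "f \<in> borel_measurable borel"
    using f by (intro borel_measurable_continuous_onI) auto
  have "f \<in> borel_measurable L"
    using meas by (simp add: measurable_cong_sets[OF L(2) refl])
  then have intL: "integrable L f"
    by (intro L.integrable_const_bound[where B = B]) (use B in auto)
  have "f \<in> borel_measurable (P n)" for n
    using meas by (simp add: measurable_cong_sets[OF P(2) refl])
  then have intP: "integrable (P n) f" for n
    by (intro P.integrable_const_bound[where B = B]) (use B in auto)
  have "\<And>y. - B \<le> f y" "\<And>y. f y \<le> B" using B by (auto simp: abs_le_iff minus_le_iff)
  then have bounds: "0 \<le> f y + B" "f y + B \<le> 2 * B" "0 \<le> B - f y" "B - f y \<le> 2 * B" for y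
    by (simp_all add: algebra_simps) (smt (verit))+
  show "(\<lambda>n. integral\<^sup>L (P n) f) \<longlonglongrightarrow> integral\<^sup>L L f"
  proof (rule tendstoI)
    fix e :: real assume e: "0 < e"
    have "continuous_on UNIV (\<lambda>y. f y + B)" "continuous_on UNIV (\<lambda>y. B - f y)"
      using f by (auto intro!: continuous_intros)
    then have "\<forall>\<^sub>F n in sequentially. integral\<^sup>L L (\<lambda>y. f y + B) - e < integral\<^sup>L (P n) (\<lambda>y. f y + B)"
      "\<forall>\<^sub>F n in sequentially. integral\<^sup>L L (\<lambda>y. B - f y) - e < integral\<^sup>L (P n) (\<lambda>y. B - f y)"
      using liminf_integral_ge[OF P L AE cells _ _ _ e, of "\<lambda>y. f y + B" "2 * B"]
        liminf_integral_ge[OF P L AE cells _ _ _ e, of "\<lambda>y. B - f y" "2 * B"] bounds by simp_all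
    then show "\<forall>\<^sub>F n in sequentially. dist (integral\<^sup>L (P n) f) (integral\<^sup>L L f) < e"
    proof eventually_elim
      case (elim n)
      with intL intP[of n] show ?case
        by (simp add: L.prob_space P.prob_space dist_real_def abs_less_iff)
    qed
  qed
qed

section \<open>Cell probabilities of the Poisson points\<close>

abbreviation exp_law :: "real measure" where
  "exp_law \<equiv> density lborel (exponential_density 1)"

lemma prob_space_exp_law: "prob_space exp_law"
  by (rule prob_space_exponential_density) simp

lemma AE_exp_law_pos: "AE x in exp_law. 0 < x"
proof -
  have "AE x in lborel. x \<noteq> (0::real)"
    by (rule AE_lborel_singleton)
  then show ?thesis
    by (subst AE_density) (auto simp: exponential_density_def elim!: eventually_mono split: if_splits)
qed

definition partial_sums :: "nat \<Rightarrow> (nat \<Rightarrow> real) \<Rightarrow> nat \<Rightarrow> real" where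
  "partial_sums k E = (\<lambda>i. if i < k then (\<Sum>j\<le>i. E j) else 0)"

lemma poisson_first_points_eq: "poisson_first_points k = distr (Pi\<^sub>M {..<k} (\<lambda>_. exp_law)) borel (partial_sums k)"
  by (simp add: poisson_first_points_def partial_sums_def [abs_def])

lemma measurable_partial_sum:
  fixes i k :: nat
  assumes "i < k"
  shows "(\<lambda>E. \<Sum>j\<le>i. E j) \<in> borel_measurable (Pi\<^sub>M {..<k} (\<lambda>_. exp_law))"
proof (rule borel_measurable_sum)
  fix j assume "j \<in> {..i}"
  then have "(\<lambda>E. E j) \<in> measurable (Pi\<^sub>M {..<k} (\<lambda>_. exp_law)) exp_law"
    using assms by (intro measurable_component_singleton) (auto dest: le_less_trans)
  then show "(\<lambda>E. E j) \<in> borel_measurable (Pi\<^sub>M {..<k} (\<lambda>_. exp_law))"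
    by (simp add: measurable_cong_sets[OF refl sets_density])
qed

lemma measurable_partial_sums: "partial_sums k \<in> borel_measurable (Pi\<^sub>M {..<k} (\<lambda>_. exp_law))"
proof (rule measurable_coordinatewise_then_product)
  fix i show "(\<lambda>E. partial_sums k E i) \<in> borel_measurable (Pi\<^sub>M {..<k} (\<lambda>_. exp_law))"
    using measurable_partial_sum[of i k] by (cases "i < k") (auto simp: partial_sums_def)
qed

lemma prob_space_poisson_first_points: "prob_space (poisson_first_points k)"
  unfolding poisson_first_points_eq
  by (intro prob_space.prob_space_distr measurable_partial_sums prob_space_PiM prob_space_exp_law)

lemma AE_poisson_first_points:
  "AE y in poisson_first_points k. (\<forall>i<k. 0 < y i) \<and> (\<forall>j<k. \<forall>i<j. y i < y j) \<and> (\<forall>i\<ge>k. y i = 0)"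
proof -
  have "AE E in Pi\<^sub>M {..<k} (\<lambda>_. exp_law). \<forall>j\<in>{..<k}. 0 < E j"
    by (intro eventually_ball_finite ballI AE_PiM_component prob_space_exp_law AE_exp_law_pos) auto
  then have "AE E in Pi\<^sub>M {..<k} (\<lambda>_. exp_law). (\<forall>i<k. 0 < partial_sums k E i) \<and>
      (\<forall>j<k. \<forall>i<j. partial_sums k E i < partial_sums k E j) \<and> (\<forall>i\<ge>k. partial_sums k E i = 0)"
  proof eventually_elim
    case (elim E)
    have "(\<Sum>l\<le>i. E l) < (\<Sum>l\<le>j. E l)" if "i < j" "j < k" for i j
      using elim that by (intro sum_strict_mono2[of _ _ j]) (auto intro: less_imp_le)
    moreover have "0 < (\<Sum>l\<le>i. E l)" if "i < k" for i
      using elim that by (intro sum_pos) auto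
    ultimately show ?case by (auto simp: partial_sums_def)
  qed
  moreover have "{y \<in> space borel. (\<forall>i<k. 0 < y i) \<and> (\<forall>j<k. \<forall>i<j. y i < y j) \<and> (\<forall>i\<ge>k. y i = 0)}
      \<in> sets (borel :: (nat \<Rightarrow> real) measure)"
    by measurable
  ultimately show ?thesis
    unfolding poisson_first_points_eq by (subst AE_distr_iff[OF measurable_partial_sums]) auto
qed

lemma measurable_exp_weight:
  "(\<lambda>y::real. ennreal (exp y) * indicator {a<..b} y) \<in> borel_measurable borel"
  by measurable

text \<open>The weight \<open>exp y\<close> cancels the density on the nonnegative half-line and
  leaves Lebesgue measure; an inequality, since the shifted interval may reach below 0. The shift
  \<open>s\<close> will be the sum of the earlier gaps.\<close>

lemma nn_integral_exp_law_le:
  assumes "a \<le> b"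
  shows "(\<integral>\<^sup>+ y. ennreal (exp y) * indicator {a - s<..b - s} (y::real) \<partial>exp_law) \<le> ennreal (b - a)"
proof -
  have "(\<integral>\<^sup>+ y. ennreal (exp y) * indicator {a - s<..b - s} y \<partial>exp_law)
      = (\<integral>\<^sup>+ y. ennreal (exponential_density 1 y) * (ennreal (exp y) * indicator {a - s<..b - s} y) \<partial>lborel)"
  proof (rule nn_integral_density)
    show "(\<lambda>y. ennreal (exponential_density 1 y)) \<in> borel_measurable lborel"
      by (intro measurable_compose[OF _ measurable_ennreal]) simp
    show "(\<lambda>y. ennreal (exp y) * indicator {a - s<..b - s} y) \<in> borel_measurable lborel"
      using measurable_exp_weight by simp
  qed
  also have "\<dots> \<le> (\<integral>\<^sup>+ y. indicator {a - s<..b - s} y \<partial>lborel)"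
    by (intro nn_integral_mono)
      (auto simp: exponential_density_def indicator_def exp_minus simp flip: ennreal_mult)
  also have "\<dots> = ennreal (b - a)"
    using assms by simp
  finally show ?thesis .
qed

text \<open>The weight \<open>exp\<close> of the last point cancels the density of the exponential gaps, so that each
  coordinate contributes at most the length of its interval.\<close>

lemma nn_integral_partial_sums_box_le:
  fixes a b :: "nat \<Rightarrow> real"
  assumes "\<And>i. a i \<le> b i"
  shows "(\<integral>\<^sup>+ E. ennreal (exp (\<Sum>j<k. E j)) * (\<Prod>i<k. indicator {a i<..b i} (\<Sum>j\<le>i. E j))
      \<partial>Pi\<^sub>M {..<k} (\<lambda>_. exp_law)) \<le> (\<Prod>i<k. ennreal (b i - a i))"
proof (induction k)
  case 0
  show ?case by (simp add: PiM_empty nn_integral_count_space_finite)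
next
  case (Suc k)
  interpret product_prob_space "\<lambda>_::nat. exp_law" "{..<k}"
    unfolding product_prob_space_def product_sigma_finite_def product_prob_space_axioms_def
    using prob_space_exp_law by (auto intro: prob_space_imp_sigma_finite)
  let ?f = "\<lambda>k E. ennreal (exp (\<Sum>j<k. E j)) * (\<Prod>i<k. indicator {a i<..b i} (\<Sum>j\<le>i. E j))"
  have meas: "?f k \<in> borel_measurable (Pi\<^sub>M {..<k} (\<lambda>_. exp_law))" for k
  proof (intro borel_measurable_times_ennreal borel_measurable_prod_ennreal)
    have "(\<lambda>E. \<Sum>j<k. E j) \<in> borel_measurable (Pi\<^sub>M {..<k} (\<lambda>_. exp_law))"
      by (cases k) (auto simp: lessThan_Suc_atMost intro!: measurable_partial_sum[of _ "Suc _", simplified lessThan_Suc_atMost])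
    then show "(\<lambda>E. ennreal (exp (\<Sum>j<k. E j))) \<in> borel_measurable (Pi\<^sub>M {..<k} (\<lambda>_. exp_law))"
      by measurable
    fix i assume "i \<in> {..<k}"
    then have [measurable]: "(\<lambda>E. \<Sum>j\<le>i. E j) \<in> borel_measurable (Pi\<^sub>M {..<k} (\<lambda>_. exp_law))"
      by (intro measurable_partial_sum) simp
    show "(\<lambda>E. indicator {a i<..b i} (\<Sum>j\<le>i. E j) :: ennreal) \<in> borel_measurable (Pi\<^sub>M {..<k} (\<lambda>_. exp_law))"
      by measurable
  qed
  \<comment> \<open>Adding one gap \<open>y\<close> multiplies the weight by \<open>exp y\<close>,
    and the new point lies in its interval exactly when \<open>y\<close> lies in that interval
    shifted back by the previous point.\<close>
  have split: "?f (Suc k) (x(k := y)) =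
      ?f k x * (ennreal (exp y) * indicator {a k - (\<Sum>j<k. x j)<..b k - (\<Sum>j<k. x j)} y)" for x y
  proof -
    have "(\<Sum>j\<le>i. (x(k := y)) j) = (\<Sum>j\<le>i. x j)" if "i < k" for i
      using that by (intro sum.cong) auto
    moreover have s: "(\<Sum>j<k. (x(k := y)) j) = (\<Sum>j<k. x j)"
      by (intro sum.cong) auto
    moreover have "(\<Sum>j\<le>k. (x(k := y)) j) = (\<Sum>j<k. x j) + y"
      using s by (simp add: lessThan_Suc_atMost[symmetric])
    moreover have "(indicator {a k<..b k} ((\<Sum>j<k. x j) + y) :: ennreal)
        = indicator {a k - (\<Sum>j<k. x j)<..b k - (\<Sum>j<k. x j)} y"
      by (auto simp: indicator_def)
    ultimately show ?thesis
      by (simp add: exp_add ennreal_mult mult_ac)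
  qed
  have "(\<integral>\<^sup>+ E. ?f (Suc k) E \<partial>Pi\<^sub>M {..<Suc k} (\<lambda>_. exp_law))
      = (\<integral>\<^sup>+ x. (\<integral>\<^sup>+ y. ?f (Suc k) (x(k := y)) \<partial>exp_law) \<partial>Pi\<^sub>M {..<k} (\<lambda>_. exp_law))"
    using meas[of "Suc k"] unfolding lessThan_Suc
    by (intro product_nn_integral_insert) auto
  also have "\<dots> = (\<integral>\<^sup>+ x. ?f k x * (\<integral>\<^sup>+ y. ennreal (exp y) *
      indicator {a k - (\<Sum>j<k. x j)<..b k - (\<Sum>j<k. x j)} y \<partial>exp_law) \<partial>Pi\<^sub>M {..<k} (\<lambda>_. exp_law))"
    unfolding split using measurable_exp_weight by (intro nn_integral_cong nn_integral_cmult) simp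
  also have "\<dots> \<le> (\<integral>\<^sup>+ x. ?f k x * ennreal (b k - a k) \<partial>Pi\<^sub>M {..<k} (\<lambda>_. exp_law))"
    by (intro nn_integral_mono mult_left_mono nn_integral_exp_law_le assms) simp
  also have "\<dots> = (\<integral>\<^sup>+ x. ?f k x \<partial>Pi\<^sub>M {..<k} (\<lambda>_. exp_law)) * ennreal (b k - a k)"
    by (rule nn_integral_multc[OF meas])
  also have "\<dots> \<le> (\<Prod>i<k. ennreal (b i - a i)) * ennreal (b k - a k)"
    by (intro mult_right_mono Suc.IH) simp
  finally show ?case by simp
qed

text \<open>Markov's inequality for the exponential of the last point, which is at least
  \<open>exp (c k / m)\<close> on the cell. An upper bound is the useful direction, as this mass is
  to be dominated by Mallows probabilities.\<close>

lemma poisson_first_points_grid_cell_le: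
  assumes "0 < m"
  shows "measure (poisson_first_points (Suc k)) (grid_cell (Suc k) m c)
    \<le> (1 / real m) ^ Suc k * exp (- real (c k) / real m)"
proof -
  let ?Pi = "Pi\<^sub>M {..<Suc k} (\<lambda>_. exp_law)"
  let ?a = "\<lambda>i. real (c i) / real m" and ?b = "\<lambda>i. (real (c i) + 1) / real m"
  interpret Pi: prob_space ?Pi by (intro prob_space_PiM prob_space_exp_law)
  let ?A = "partial_sums (Suc k) -` grid_cell (Suc k) m c \<inter> space ?Pi"
  have A: "?A \<in> sets ?Pi"
    by (rule measurable_sets[OF measurable_partial_sums grid_cell_in_borel])
  have diff: "?b i - ?a i = 1 / real m" for i
    by (simp add: add_divide_distrib)
  have "ennreal (exp (?a k)) * emeasure ?Pi ?A = (\<integral>\<^sup>+ E. ennreal (exp (?a k)) * indicator ?A E \<partial>?Pi)"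
    using A by (rule nn_integral_cmult_indicator[symmetric])
  also have "\<dots> \<le> (\<integral>\<^sup>+ E. ennreal (exp (\<Sum>j<Suc k. E j)) * (\<Prod>i<Suc k. indicator {?a i<..?b i} (\<Sum>j\<le>i. E j)) \<partial>?Pi)"
  proof (rule nn_integral_mono)
    fix E
    show "ennreal (exp (?a k)) * indicator ?A E
      \<le> ennreal (exp (\<Sum>j<Suc k. E j)) * (\<Prod>i<Suc k. indicator {?a i<..?b i} (\<Sum>j\<le>i. E j))"
    proof (cases "E \<in> ?A")
      case True
      then have *: "(\<Sum>j\<le>i. E j) \<in> {?a i<..?b i}" if "i < Suc k" for i
        using that by (auto simp: grid_cell_def partial_sums_def dest!: spec[of _ i])
      then have "(\<Prod>i<Suc k. indicator {?a i<..?b i} (\<Sum>j\<le>i. E j)) = (1 :: ennreal)"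
        by (intro prod.neutral) auto
      moreover have "?a k \<le> (\<Sum>j<Suc k. E j)"
        using *[of k] by (simp add: lessThan_Suc_atMost)
      ultimately show ?thesis using True by (simp add: ennreal_leI)
    qed simp
  qed
  also have "\<dots> \<le> (\<Prod>i<Suc k. ennreal (?b i - ?a i))"
    by (rule nn_integral_partial_sums_box_le) (auto simp: divide_right_mono)
  also have "\<dots> = ennreal ((1 / real m) ^ Suc k)"
    unfolding diff by (subst prod_ennreal) auto
  finally have le: "exp (?a k) * measure ?Pi ?A \<le> (1 / real m) ^ Suc k"
    by (simp add: Pi.emeasure_eq_measure flip: ennreal_mult)
  have "measure ?Pi ?A = exp (- ?a k) * (exp (?a k) * measure ?Pi ?A)"
    by (simp only: mult.assoc[symmetric] exp_add[symmetric]) simp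
  also have "\<dots> \<le> exp (- ?a k) * (1 / real m) ^ Suc k"
    by (intro mult_left_mono le) simp
  finally have "measure ?Pi ?A \<le> (1 / real m) ^ Suc k * exp (- ?a k)"
    by (simp only: mult.commute)
  then show ?thesis
    by (simp add: poisson_first_points_eq measure_distr[OF measurable_partial_sums grid_cell_in_borel])
qed

section \<open>Jump patterns of regular Mallows processes\<close>

text \<open>The exact count is the product of \<open>n - 1 - i\<close> over \<open>i < k\<close>,
  each factor at least \<open>n - k\<close>. The targets start at 2 because index 1 never has an
  inversion.\<close>

lemma card_injections_ge:
  assumes "k \<le> n"
  shows "(n - k) ^ k \<le> card {J \<in> {..<k} \<rightarrow>\<^sub>E {2..n}. inj_on J {..<k}}"
proof -
  have "(n - k) ^ k = (\<Prod>i\<in>{0..<k}. n - k)" by simp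
  also have "\<dots> \<le> (\<Prod>i\<in>{0..<k}. card {2..n} - i)"
    by (intro prod_mono) auto
  also have "\<dots> = card {J \<in> {..<k} \<rightarrow>\<^sub>E {2..n}. inj_on J {..<k}}"
    by (subst card_inj_on_subset_funcset) auto
  finally show ?thesis .
qed

context
  fixes n :: nat and \<Omega> :: "'a measure" and X :: "real \<Rightarrow> 'a \<Rightarrow> nat \<Rightarrow> nat"
    and k :: nat and a b :: "nat \<Rightarrow> real"
  assumes prob: "prob_space \<Omega>" and monotone: "monotone_mallows_process n \<Omega> X"
    and regular: "regular_mallows_process n \<Omega> X"
    and a_nonneg: "\<And>i. 0 \<le> a i" and ab: "\<And>i. a i < b i"
    and ba: "\<And>i j. i < j \<Longrightarrow> j \<le> k \<Longrightarrow> b i \<le> a j" and b_less_1: "b k < 1"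
begin

interpretation prob_space \<Omega> by (rule prob)

lemma regular_mallows_processD:
  shows "mallows_process n \<Omega> X"
    and "\<And>\<omega> j s t. \<omega> \<in> space \<Omega> \<Longrightarrow> j \<in> {1..n} \<Longrightarrow> 0 \<le> s \<Longrightarrow> s \<le> t \<Longrightarrow>
      inversions_at (X s \<omega>) j \<le> inversions_at (X t \<omega>) j"
    and "indep_vars (\<lambda>j. Pi\<^sub>M {0..} (\<lambda>_. count_space UNIV))
       (\<lambda>j \<omega>. \<lambda>t\<in>{0::real..}. inversions_at (X t \<omega>) j) {1..n}"
  using regular
  by (simp_all add: regular_mallows_process_def smooth_mallows_process_def strongly_monotone_mallows_process_def)

lemma b_mono: "i \<le> j \<Longrightarrow> j \<le> k \<Longrightarrow> b i \<le> b j"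
  using ba[of i j] ab[of j] by (cases "i = j") auto

lemma a_mono: "i \<le> j \<Longrightarrow> j \<le> k \<Longrightarrow> a i \<le> a j"
  using ba[of i j] ab[of i] by (cases "i = j") auto

lemma b_nonneg: "0 \<le> b i"
  using a_nonneg[of i] ab[of i] by simp

text \<open>The event that up to time \<open>b k\<close> exactly the processes with index \<open>J 0, \<dots>, J k\<close> jump, each of them once
  and \<open>J i\<close> between the times \<open>a i\<close> and \<open>b i\<close>, split into the contributions of the single indices.\<close>

definition pattern_at :: "(nat \<Rightarrow> nat) \<Rightarrow> nat \<Rightarrow> (real \<Rightarrow> nat) \<Rightarrow> bool" where
  "pattern_at J j p \<longleftrightarrow> (\<forall>i\<in>{i. i \<le> k \<and> J i = j}. p (a i) = 0 \<and> 1 \<le> p (b i) \<and> p (b k) < 2)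
    \<and> (j \<notin> J ` {..k} \<longrightarrow> p (b k) = 0)"

definition pattern :: "(nat \<Rightarrow> nat) \<Rightarrow> 'a set" where
  "pattern J = {\<omega> \<in> space \<Omega>. \<forall>j\<in>{1..n}. pattern_at J j (\<lambda>t. inversions_at (X t \<omega>) j)}"

text \<open>A pattern inspects the path only at the finitely many times \<open>a i\<close>,
  \<open>b i\<close> and \<open>b k\<close>, so it is measurable in the product over the uncountable
  time set, in which independence is stated.\<close>

lemma pattern_at_sets:
  "{p \<in> space (Pi\<^sub>M {0..} (\<lambda>_. count_space UNIV)). pattern_at J j p} \<in> sets (Pi\<^sub>M {0..} (\<lambda>_. count_space UNIV))"
proof -
  have comp: "Measurable.pred (Pi\<^sub>M {0..} (\<lambda>_. count_space UNIV)) (\<lambda>p. Q (p s))" if "0 \<le> s" for s :: real and Q :: "nat \<Rightarrow> bool"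
    using that by (intro measurable_compose[OF measurable_component_singleton]) auto
  have "finite {i. i \<le> k \<and> J i = j}" by simp
  then have "Measurable.pred (Pi\<^sub>M {0..} (\<lambda>_. count_space UNIV)) (pattern_at J j)"
    unfolding pattern_at_def
    by (intro pred_intros_logic pred_intros_finite comp a_nonneg b_nonneg)
  then show ?thesis by (simp add: pred_def)
qed

lemma prob_pattern:
  assumes "n \<ge> 1"
  shows "pattern J \<in> events"
    and "prob (pattern J) = (\<Prod>j\<in>{1..n}. prob {\<omega> \<in> space \<Omega>. pattern_at J j (\<lambda>t. inversions_at (X t \<omega>) j)})"
proof -
  let ?N = "Pi\<^sub>M {0..} (\<lambda>_. count_space UNIV) :: (real \<Rightarrow> nat) measure"
  let ?Y = "\<lambda>j \<omega>. \<lambda>t\<in>{0::real..}. inversions_at (X t \<omega>) j"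
  let ?A = "\<lambda>j. {p \<in> space ?N. pattern_at J j p}"
  have Y: "?Y j -` ?A j \<inter> space \<Omega> = {\<omega> \<in> space \<Omega>. pattern_at J j (\<lambda>t. inversions_at (X t \<omega>) j)}" for j
    using a_nonneg b_nonneg by (auto simp: pattern_at_def space_PiM)
  have G: "pattern J = (\<Inter>j\<in>{1..n}. ?Y j -` ?A j \<inter> space \<Omega>)"
    unfolding Y pattern_def using assms by auto
  show "prob (pattern J) = (\<Prod>j\<in>{1..n}. prob {\<omega> \<in> space \<Omega>. pattern_at J j (\<lambda>t. inversions_at (X t \<omega>) j)})"
  proof -
    have "prob (pattern J) = (\<Prod>j\<in>{1..n}. prob (?Y j -` ?A j \<inter> space \<Omega>))"
      unfolding G using assms pattern_at_sets
      by (intro indep_varsD_finite[OF regular_mallows_processD(3)]) simp_all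
    then show ?thesis by (simp only: Y)
  qed
  have "?Y j \<in> measurable \<Omega> ?N" if "j \<in> {1..n}" for j
    using regular_mallows_processD(3) that unfolding indep_vars_def by blast
  then have "?Y j -` ?A j \<inter> space \<Omega> \<in> events" if "j \<in> {1..n}" for j
    using that by (intro measurable_sets[OF _ pattern_at_sets]) auto
  then show "pattern J \<in> events"
    unfolding G using assms by (intro sets.finite_INT) auto
qed

text \<open>Union bound: being 0 at \<open>a i\<close> implies the event, or still being 0 at
  \<open>b i\<close>, or a value of at least 2 at \<open>b k\<close>. The difference of the first
  and second zero probabilities is \<open>qint (b i) j - qint (a i) j\<close> over the product of
  both, whence the two factors \<open>1 - b k\<close>.\<close>

lemma prob_single_jump_ge:
  assumes "j \<in> {2..n}" "i \<le> k" "d \<le> b i - a i" "0 \<le> d"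
  shows "d * (1 - b k)\<^sup>2 - (b k)\<^sup>2 \<le> prob {\<omega> \<in> space \<Omega>. inversions_at (X (a i) \<omega>) j = 0 \<and>
    1 \<le> inversions_at (X (b i) \<omega>) j \<and> inversions_at (X (b k) \<omega>) j < 2}"
proof -
  note sets = mallows_process_pred_sets[OF prob regular_mallows_processD(1)]
  let ?E = "{\<omega> \<in> space \<Omega>. inversions_at (X (a i) \<omega>) j = 0 \<and>
    1 \<le> inversions_at (X (b i) \<omega>) j \<and> inversions_at (X (b k) \<omega>) j < 2}"
  let ?A = "{\<omega> \<in> space \<Omega>. inversions_at (X (a i) \<omega>) j = 0}"
  let ?B = "{\<omega> \<in> space \<Omega>. inversions_at (X (b i) \<omega>) j = 0}"
  let ?C = "{\<omega> \<in> space \<Omega>. 2 \<le> inversions_at (X (b k) \<omega>) j}"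
  have A: "?A \<in> events" by (rule sets[OF a_nonneg])
  have B: "?B \<in> events" by (rule sets[OF b_nonneg])
  have C: "?C \<in> events" by (rule sets[OF b_nonneg])
  have "?E = ?A - ?B - ?C" by auto
  with A B C have E: "?E \<in> events" by (simp only: sets.Diff)
  have "prob ?A \<le> prob (?E \<union> (?B \<union> ?C))"
    by (intro finite_measure_mono sets.Un E B C) auto
  also have "\<dots> \<le> prob ?E + prob (?B \<union> ?C)"
    by (intro measure_Un_le sets.Un E B C)
  also have "\<dots> \<le> prob ?E + (prob ?B + prob ?C)"
    by (intro add_left_mono measure_Un_le B C)
  finally have "prob ?A - prob ?B - prob ?C \<le> prob ?E" by simp
  moreover have j: "j \<in> {1..n}" using assms by auto
  moreover have "prob ?A = 1 / qint (a i) j" "prob ?B = 1 / qint (b i) j"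
    by (rule prob_inversions_at_eq_0[OF prob regular_mallows_processD(1) _ j], rule a_nonneg b_nonneg)+
  moreover have "prob ?C \<le> (b k)\<^sup>2"
    by (rule prob_inversions_at_ge_2[OF prob regular_mallows_processD(1) b_nonneg b_less_1 assms(1)])
  moreover have "d * (1 - b k)\<^sup>2 \<le> 1 / qint (a i) j - 1 / qint (b i) j"
  proof -
    have le: "a i \<le> b i" "b i \<le> b k" using ab[of i] b_mono[OF assms(2)] by auto
    have pos: "1 \<le> qint (a i) j" "1 \<le> qint (b i) j"
      using a_nonneg b_nonneg assms by (auto intro!: qint_ge_1)
    have inv: "1 - b k \<le> 1 / qint (a i) j" "1 - b k \<le> 1 / qint (b i) j"
      using qint_le_inverse[of "a i" j] qint_le_inverse[of "b i" j] a_nonneg[of i] b_nonneg[of i] le b_less_1 assms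
      by auto
    have "d \<le> qint (b i) j - qint (a i) j"
      using qint_diff_ge[of "a i" "b i" j] a_nonneg le assms by auto
    then have "d * ((1 - b k) * (1 - b k)) \<le> (qint (b i) j - qint (a i) j) * (1 / qint (a i) j * (1 / qint (b i) j))"
      using inv b_less_1 pos assms(4) by (intro mult_mono) auto
    also have "\<dots> = 1 / qint (a i) j - 1 / qint (b i) j"
      using pos by (simp add: field_simps)
    finally show ?thesis by (simp add: power2_eq_square)
  qed
  ultimately show ?thesis by linarith
qed

text \<open>By independence each of the \<open>Suc k\<close> jumping indices contributes the
  single-jump bound and every other index at least \<open>1 - b k\<close>. The hypothesis
  \<open>p\<close> keeps the factors nonnegative, so that the inequalities may be
  multiplied.\<close>

lemma prob_pattern_ge:
  assumes J: "J \<in> {..k} \<rightarrow> {2..n}" "inj_on J {..k}"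
    and d: "\<And>i. i \<le> k \<Longrightarrow> d \<le> b i - a i" "0 \<le> d" and p: "0 \<le> d * (1 - b k)\<^sup>2 - (b k)\<^sup>2"
  shows "(d * (1 - b k)\<^sup>2 - (b k)\<^sup>2) ^ Suc k * (1 - b k) ^ n \<le> prob (pattern J)"
proof -
  let ?p = "d * (1 - b k)\<^sup>2 - (b k)\<^sup>2"
  let ?g = "\<lambda>j. prob {\<omega> \<in> space \<Omega>. pattern_at J j (\<lambda>t. inversions_at (X t \<omega>) j)}"
  have J2: "J i \<in> {2..n}" if "i \<le> k" for i using J(1) that by auto
  have sub: "J ` {..k} \<subseteq> {1..n}" using J2 by force
  have n: "n \<ge> 1" using J2[of 0] by auto
  have on: "?p \<le> ?g (J i)" if "i \<le> k" for i
  proof -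
    \<comment> \<open>Injectivity leaves one index in the quantifier of \<open>pattern_at\<close>,
      which then is the event of \<open>prob_single_jump_ge\<close>.\<close>
    have "{i'. i' \<le> k \<and> J i' = J i} = {i}"
      using that inj_onD[OF J(2)] by auto
    then have "pattern_at J (J i) p \<longleftrightarrow> p (a i) = 0 \<and> 1 \<le> p (b i) \<and> p (b k) < 2" for p
      using that by (simp add: pattern_at_def)
    with prob_single_jump_ge[OF J2[OF that] that d(1)[OF that] d(2)] show ?thesis by simp
  qed
  have off: "1 - b k \<le> ?g j" if "j \<in> {1..n} - J ` {..k}" for j
  proof -
    have "pattern_at J j p \<longleftrightarrow> p (b k) = 0" for p
      using that by (auto simp: pattern_at_def)
    then have "?g j = 1 / qint (b k) j"
      using prob_inversions_at_eq_0[OF prob regular_mallows_processD(1) b_nonneg, of j k] that by simp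
    then show ?thesis
      using qint_le_inverse[OF b_nonneg b_less_1, of j] that by simp
  qed
  \<comment> \<open>The exponent is rounded up to \<open>n\<close>; the \<open>Suc k\<close> extra
    factors tend to 1.\<close>
  have "card ({1..n} - J ` {..k}) \<le> card {1..n}" by (intro card_mono) auto
  then have "(1 - b k) ^ n \<le> (1 - b k) ^ card ({1..n} - J ` {..k})"
    using b_less_1 b_nonneg[of k] by (intro power_decreasing) auto
  also have "\<dots> = (\<Prod>j\<in>{1..n} - J ` {..k}. 1 - b k)" by simp
  also have "\<dots> \<le> (\<Prod>j\<in>{1..n} - J ` {..k}. ?g j)"
    using off b_less_1 by (intro prod_mono) auto
  finally have off': "(1 - b k) ^ n \<le> (\<Prod>j\<in>{1..n} - J ` {..k}. ?g j)" .
  have "?p ^ Suc k = (\<Prod>i\<in>{..k}. ?p)" by simp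
  also have "\<dots> \<le> (\<Prod>i\<in>{..k}. ?g (J i))"
    using on p by (intro prod_mono) auto
  also have "\<dots> = (\<Prod>j\<in>J ` {..k}. ?g j)"
    by (simp add: prod.reindex[OF J(2)])
  finally have on': "?p ^ Suc k \<le> (\<Prod>j\<in>J ` {..k}. ?g j)" .
  have "?p ^ Suc k * (1 - b k) ^ n \<le> (\<Prod>j\<in>J ` {..k}. ?g j) * (\<Prod>j\<in>{1..n} - J ` {..k}. ?g j)"
    using b_less_1 by (intro mult_mono on' off' prod_nonneg) auto
  also have "\<dots> = (\<Prod>j\<in>{1..n}. ?g j)"
    using prod.subset_diff[OF sub, of ?g] by (simp add: mult.commute)
  also have "\<dots> = prob (pattern J)"
    by (rule prob_pattern(2)[OF n, symmetric])
  finally show ?thesis .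
qed

text \<open>The index \<open>J i\<close> jumps before \<open>b k\<close>, so the second pattern must
  use it too, at some \<open>i' \<noteq> i\<close>. It would then be positive at the end of the
  earlier interval and 0 at the start of the later one, against monotonicity.\<close>

lemma pattern_disjoint:
  assumes J: "J \<in> {..k} \<rightarrow> {1..n}" and J': "J' \<in> {..k} \<rightarrow> {1..n}"
    and \<omega>: "\<omega> \<in> pattern J" "\<omega> \<in> pattern J'" and i: "i \<le> k"
  shows "J i = J' i"
proof (rule ccontr)
  assume ne: "J i \<noteq> J' i"
  let ?N = "\<lambda>t. inversions_at (X t \<omega>) (J i)"
  have sp: "\<omega> \<in> space \<Omega>" and j: "J i \<in> {1..n}"
    using \<omega> J i by (auto simp: pattern_def)
  have mono: "?N s \<le> ?N t" if "0 \<le> s" "s \<le> t" for s t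
    using regular_mallows_processD(2)[OF sp j that] .
  have pat: "pattern_at J (J i) ?N" "pattern_at J' (J i) ?N"
    using \<omega> j by (auto simp: pattern_def)
  have i0: "?N (a i) = 0" "1 \<le> ?N (b i)"
    using pat(1) i by (auto simp: pattern_at_def)
  have "1 \<le> ?N (b k)"
    using i0(2) mono[OF b_nonneg b_mono[OF i order_refl]] by linarith
  then have "J i \<in> J' ` {..k}"
    using pat(2) by (auto simp: pattern_at_def)
  then obtain i' where i': "i' \<le> k" "J i = J' i'" by auto
  then have i'0: "?N (a i') = 0" "1 \<le> ?N (b i')"
    using pat(2) by (auto simp: pattern_at_def)
  have "i' \<noteq> i" using ne i'(2) by auto
  then show False
  proof (cases "i < i'")
    case True
    with mono[OF b_nonneg ba[OF True i'(1)]] i0 i'0 show False by linarith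
  next
    case False
    with \<open>i' \<noteq> i\<close> have "i' < i" by simp
    with mono[OF b_nonneg ba[OF this i]] i0 i'0 show False by linarith
  qed
qed

text \<open>At time \<open>a i\<close> only \<open>J 0, ..., J (i - 1)\<close> can be positive, each
  with value at most 1, so there are at most \<open>i\<close> inversions; at \<open>b i\<close> the
  indices \<open>J 0, ..., J i\<close> are all positive, so there are at least
  \<open>Suc i\<close>.\<close>

lemma pattern_jump_time:
  assumes J: "J \<in> {..k} \<rightarrow> {1..n}" "inj_on J {..k}" and \<omega>: "\<omega> \<in> pattern J" and i: "i \<le> k"
  shows "a i < jump_time n X (Suc i) \<omega>" "jump_time n X (Suc i) \<omega> \<le> b i"
proof -
  have sp: "\<omega> \<in> space \<Omega>" using \<omega> by (auto simp: pattern_def)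
  note mono = regular_mallows_processD(2)[OF sp]
  have pat: "pattern_at J j (\<lambda>t. inversions_at (X t \<omega>) j)" if "j \<in> {1..n}" for j
    using \<omega> that by (auto simp: pattern_def)
  have jump: "inversions_at (X (a i') \<omega>) (J i') = 0" "1 \<le> inversions_at (X (b i') \<omega>) (J i')"
    "inversions_at (X (b k) \<omega>) (J i') < 2" if "i' \<le> k" for i'
  proof -
    have "J i' \<in> {1..n}" using J(1) that by auto
    from pat[OF this] that show "inversions_at (X (a i') \<omega>) (J i') = 0"
      "1 \<le> inversions_at (X (b i') \<omega>) (J i')" "inversions_at (X (b k) \<omega>) (J i') < 2"
      by (auto simp: pattern_at_def)
  qed
  have "inversions n (X (a i) \<omega>) = (\<Sum>j\<in>{1..n}. inversions_at (X (a i) \<omega>) j)"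
    by (rule inversions_eq_sum_inversions_at)
  also have "\<dots> \<le> (\<Sum>j\<in>{1..n}. if j \<in> J ` {..<i} then 1 else 0)"
  proof (rule sum_mono)
    fix j assume j: "j \<in> {1..n}"
    have le: "a i \<le> b k" using ab[of i] b_mono[OF i order_refl] by simp
    consider (early) "j \<in> J ` {..<i}" | (late) "j \<notin> J ` {..<i}" "j \<in> J ` {..k}" | (never) "j \<notin> J ` {..k}"
      by blast
    then show "inversions_at (X (a i) \<omega>) j \<le> (if j \<in> J ` {..<i} then 1 else 0)"
    proof cases
      case early
      then obtain i' where i': "i' < i" "j = J i'" by blast
      with i have "inversions_at (X (b k) \<omega>) j < 2" using jump(3)[of i'] by simp
      with mono[OF j a_nonneg le] early show ?thesis by simp
    next
      case late
      then obtain i' where i': "i' \<le> k" "j = J i'" by blast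
      with late(1) have "i \<le> i'" by (meson imageI lessThan_iff not_le)
      from mono[OF j a_nonneg a_mono[OF this i'(1)]] jump(1)[OF i'(1)] i'(2) show ?thesis by simp
    next
      case never
      then have "inversions_at (X (b k) \<omega>) j = 0" using pat[OF j] by (simp add: pattern_at_def)
      with mono[OF j a_nonneg le] show ?thesis by simp
    qed
  qed
  also have "\<dots> = card ({1..n} \<inter> J ` {..<i})"
    by (simp flip: sum.inter_restrict)
  also have "\<dots> \<le> card (J ` {..<i})" by (intro card_mono) auto
  also have "\<dots> \<le> card {..<i}" by (rule card_image_le) simp
  finally have up: "\<not> Suc i \<le> inversions n (X (a i) \<omega>)" by simp
  have "Suc i = card {..i}" by simp
  also have "\<dots> = card (J ` {..i})"
    using i by (intro card_image[symmetric] inj_on_subset[OF J(2)]) auto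
  also have "\<dots> = (\<Sum>j\<in>J ` {..i}. 1)" by simp
  also have "\<dots> \<le> (\<Sum>j\<in>J ` {..i}. inversions_at (X (b i) \<omega>) j)"
  proof (rule sum_mono)
    fix j assume "j \<in> J ` {..i}"
    then obtain i' where i': "i' \<le> i" "j = J i'" by auto
    with i J(1) have j: "j \<in> {1..n}" by auto
    show "1 \<le> inversions_at (X (b i) \<omega>) j"
      using mono[OF j b_nonneg b_mono[OF i'(1) i]] jump(2)[of i'] i i' by auto
  qed
  also have "\<dots> \<le> (\<Sum>j\<in>{1..n}. inversions_at (X (b i) \<omega>) j)"
    using J(1) i by (intro sum_mono2) auto
  finally have low: "Suc i \<le> inversions n (X (b i) \<omega>)"
    by (simp add: inversions_eq_sum_inversions_at)
  note iff = jump_time_le_iff[OF prob monotone sp b_nonneg low]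
  show "jump_time n X (Suc i) \<omega> \<le> b i" using iff[OF b_nonneg] low by blast
  show "a i < jump_time n X (Suc i) \<omega>" using iff[OF a_nonneg] up by (meson not_le)
qed

text \<open>Patterns of different injections are disjoint, so their probabilities add. With
  \<open>d\<close> of order \<open>1 / n\<close> the number of injections compensates the powers of
  \<open>1 / n\<close> in a single pattern.\<close>

lemma prob_jump_times_ge:
  assumes "Suc k \<le> n"
    and d: "\<And>i. i \<le> k \<Longrightarrow> d \<le> b i - a i" "0 \<le> d" and p: "0 \<le> d * (1 - b k)\<^sup>2 - (b k)\<^sup>2"
  shows "real ((n - Suc k) ^ Suc k) * ((d * (1 - b k)\<^sup>2 - (b k)\<^sup>2) ^ Suc k * (1 - b k) ^ n)
    \<le> prob {\<omega> \<in> space \<Omega>. \<forall>i<Suc k. a i < jump_time n X (Suc i) \<omega> \<and> jump_time n X (Suc i) \<omega> \<le> b i}"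
proof -
  let ?q = "(d * (1 - b k)\<^sup>2 - (b k)\<^sup>2) ^ Suc k * (1 - b k) ^ n"
  let ?JJ = "{J \<in> {..<Suc k} \<rightarrow>\<^sub>E {2..n}. inj_on J {..<Suc k}}"
  let ?T = "{\<omega> \<in> space \<Omega>. \<forall>i<Suc k. a i < jump_time n X (Suc i) \<omega> \<and> jump_time n X (Suc i) \<omega> \<le> b i}"
  have fin: "finite ?JJ" by (simp add: finite_PiE)
  have J: "J \<in> {..k} \<rightarrow> {2..n}" "inj_on J {..k}" "J \<in> {..k} \<rightarrow> {1..n}" if "J \<in> ?JJ" for J
    using that by (auto simp: lessThan_Suc_atMost PiE_def Pi_def)
  have q: "0 \<le> ?q" using p b_less_1 by simp
  have "real ((n - Suc k) ^ Suc k) * ?q \<le> real (card ?JJ) * ?q"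
    by (intro mult_right_mono q of_nat_mono card_injections_ge assms(1))
  also have "\<dots> = (\<Sum>J\<in>?JJ. ?q)" by simp
  also have "\<dots> \<le> (\<Sum>J\<in>?JJ. prob (pattern J))"
    by (intro sum_mono prob_pattern_ge J d p)
  also have "\<dots> = prob (\<Union>J\<in>?JJ. pattern J)"
  proof (rule finite_measure_finite_Union[symmetric, OF fin])
    show "pattern ` ?JJ \<subseteq> events"
      using prob_pattern(1) assms(1) by auto
    show "disjoint_family_on pattern ?JJ"
      unfolding disjoint_family_on_def
    proof (intro ballI impI)
      fix J J' assume JJ: "J \<in> ?JJ" "J' \<in> ?JJ" "J \<noteq> J'"
      show "pattern J \<inter> pattern J' = {}"
      proof (rule ccontr)
        assume "pattern J \<inter> pattern J' \<noteq> {}"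
        then obtain \<omega> where \<omega>: "\<omega> \<in> pattern J" "\<omega> \<in> pattern J'" by blast
        have "J i = J' i" if "i \<in> {..<Suc k}" for i
          using that by (intro pattern_disjoint[OF J(3)[OF JJ(1)] J(3)[OF JJ(2)] \<omega>]) auto
        moreover have "J \<in> {..<Suc k} \<rightarrow>\<^sub>E {2..n}" "J' \<in> {..<Suc k} \<rightarrow>\<^sub>E {2..n}"
          using JJ by auto
        ultimately have "J = J'" by (intro PiE_ext) auto
        with JJ(3) show False by contradiction
      qed
    qed
  qed
  also have "\<dots> \<le> prob ?T"
  proof (rule finite_measure_mono)
    show "(\<Union>J\<in>?JJ. pattern J) \<subseteq> ?T"
    proof
      fix \<omega> assume "\<omega> \<in> (\<Union>J\<in>?JJ. pattern J)"
      then obtain J where "J \<in> ?JJ" "\<omega> \<in> pattern J" by blast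
      then show "\<omega> \<in> ?T"
        using pattern_jump_time[OF J(3,2), of J \<omega>] by (auto simp: less_Suc_eq_le pattern_def)
    qed
    note [measurable] = borel_measurable_jump_time[OF prob monotone]
    show "?T \<in> events" by measurable
  qed
  finally show ?thesis .
qed

end

lemma weak_conv_jump_times_poisson:
  fixes \<Omega> :: "nat \<Rightarrow> 'a measure"
  assumes prob: "\<And>n. prob_space (\<Omega> n)"
    and mono: "\<And>n. monotone_mallows_process n (\<Omega> n) (M n)"
    and regular: "\<And>n. regular_mallows_process n (\<Omega> n) (M n)"
  shows "weak_conv_top
      (\<lambda>n. distr (\<Omega> n) borel (\<lambda>\<omega> i. if i < Suc k then real n * jump_time n (M n) (Suc i) \<omega> else 0))
      (poisson_first_points (Suc k))"
proof (rule weak_conv_top_if_grid_cells[where k = "Suc k"])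
  let ?Y = "\<lambda>n \<omega> i. if i < Suc k then real n * jump_time n (M n) (Suc i) \<omega> else 0"
  have Y: "?Y n \<in> borel_measurable (\<Omega> n)" for n
  proof (rule measurable_coordinatewise_then_product)
    fix i
    have [measurable]: "jump_time n (M n) (Suc i) \<in> borel_measurable (\<Omega> n)"
      by (rule borel_measurable_jump_time[OF prob mono])
    show "(\<lambda>\<omega>. ?Y n \<omega> i) \<in> borel_measurable (\<Omega> n)" by measurable
  qed
  show "prob_space (distr (\<Omega> n) borel (?Y n))" for n
    by (intro prob_space.prob_space_distr prob Y)
  show "sets (distr (\<Omega> n) borel (?Y n)) = sets borel" for n by simp
  show "prob_space (poisson_first_points (Suc k))" by (rule prob_space_poisson_first_points)
  show "sets (poisson_first_points (Suc k)) = sets borel" by (simp add: poisson_first_points_def)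
  show "AE y in poisson_first_points (Suc k). (\<forall>i<Suc k. 0 < y i) \<and> (\<forall>j<Suc k. \<forall>i<j. y i < y j) \<and> (\<forall>i\<ge>Suc k. y i = 0)"
    by (rule AE_poisson_first_points)
  fix m :: nat and c :: "nat \<Rightarrow> nat" and e :: real
  assume m: "0 < m" and c: "strict_mono_on {..<Suc k} c" and e: "0 < e"
  \<comment> \<open>The right end of the last interval; up to time \<open>x / n\<close> all other
    indices have to stay at 0.\<close>
  define x where "x = (real (c k) + 1) / real m"
  have x: "0 < x" using m by (simp add: x_def)
  \<comment> \<open>\<open>n\<close> times the single-jump bound for an interval of length
    \<open>1 / (m * n)\<close>, so that it has a positive limit.\<close>
  define p where "p n = 1 / real m * (1 - x / real n)\<^sup>2 - x\<^sup>2 * (1 / real n)" for n :: nat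
  \<comment> \<open>The bound of \<open>prob_jump_times_ge\<close> rescaled: each of the
    \<open>Suc k\<close> factors \<open>n - Suc k\<close> absorbs one \<open>1 / n\<close>.\<close>
  define l where "l n = ((real n - real (Suc k)) / real n * p n) ^ Suc k * (1 - x / real n) ^ n" for n :: nat
  have inv: "(\<lambda>n. 1 / real n) \<longlonglongrightarrow> 0" "(\<lambda>n. x / real n) \<longlonglongrightarrow> 0" by real_asymp+
  have p: "p \<longlonglongrightarrow> 1 / real m * (1 - 0)\<^sup>2 - x\<^sup>2 * 0"
    unfolding p_def by (intro tendsto_intros inv)
  then have "l \<longlonglongrightarrow> (1 * (1 / real m * (1 - 0)\<^sup>2 - x\<^sup>2 * 0)) ^ Suc k * exp (- x)"
    unfolding l_def by (intro tendsto_mult tendsto_power tendsto_diff_const_over_n tendsto_one_minus_power)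
  then have l: "l \<longlonglongrightarrow> (1 / real m) ^ Suc k * exp (- x)" by simp
  have "exp (- 1 / real m) * measure (poisson_first_points (Suc k)) (grid_cell (Suc k) m c)
    \<le> exp (- 1 / real m) * ((1 / real m) ^ Suc k * exp (- real (c k) / real m))"
    by (intro mult_left_mono poisson_first_points_grid_cell_le m) simp
  also have "\<dots> = (1 / real m) ^ Suc k * (exp (- 1 / real m) * exp (- real (c k) / real m))"
    by (simp only: mult.left_commute)
  \<comment> \<open>The loss factor moves the density from the left end \<open>c k / m\<close> of
    the last interval to its right end \<open>x\<close>.\<close>
  also have "exp (- 1 / real m) * exp (- real (c k) / real m) = exp (- x)"
    by (simp add: x_def add_divide_distrib flip: exp_add)
  finally have le: "exp (- 1 / real m) * measure (poisson_first_points (Suc k)) (grid_cell (Suc k) m c) - e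
      < (1 / real m) ^ Suc k * exp (- x)"
    using e by linarith
  have ev1: "\<forall>\<^sub>F n in sequentially. exp (- 1 / real m) * measure (poisson_first_points (Suc k)) (grid_cell (Suc k) m c) - e < l n"
    by (rule order_tendstoD(1)[OF l le])
  have ev2: "\<forall>\<^sub>F n in sequentially. 0 < p n"
    by (rule order_tendstoD(1)[OF p]) (use m in simp)
  have ev3: "\<forall>\<^sub>F n in sequentially. x < real n"
    using filterlim_real_sequentially by (simp add: filterlim_at_top_dense)
  show "\<forall>\<^sub>F n in sequentially. exp (- 1 / real m) * measure (poisson_first_points (Suc k)) (grid_cell (Suc k) m c) - e
      \<le> measure (distr (\<Omega> n) borel (?Y n)) (grid_cell (Suc k) m c)"
    using ev1 ev2 ev3 eventually_gt_at_top[of "Suc k"]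
  proof eventually_elim
    case (elim n)
    have n: "0 < real n" using elim(4) by simp
    \<comment> \<open>The edges of the cell divided by \<open>n\<close>, since the cell constrains
      \<open>n\<close> times the jump times.\<close>
    define a b where "a i = real (c i) / (real m * real n)" and "b i = (real (c i) + 1) / (real m * real n)" for i
    have mn: "0 < real m * real n" using m n by simp
    have bk: "b k = x / real n" by (simp add: b_def x_def)
    have d: "b i - a i = 1 / (real m * real n)" for i by (simp add: a_def b_def add_divide_distrib)
    have a0: "0 \<le> a i" for i by (simp add: a_def)
    have ab: "a i < b i" for i
      using mn by (simp add: a_def b_def divide_strict_right_mono)
    have ba: "b i \<le> a j" if "i < j" "j \<le> k" for i j
    proof -
      have "c i < c j" using c that by (auto simp: strict_mono_on_def)
      then have "real (c i) + 1 \<le> real (c j)" by linarith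
      then show ?thesis using mn by (simp add: a_def b_def divide_right_mono)
    qed
    have bk1: "b k < 1" using elim(3) n by (simp add: bk)
    have q: "1 / (real m * real n) * (1 - b k)\<^sup>2 - (b k)\<^sup>2 = p n / real n"
      unfolding bk p_def by (simp add: diff_divide_distrib power_divide power2_eq_square)
    have "l n = real ((n - Suc k) ^ Suc k) * ((1 / (real m * real n) * (1 - b k)\<^sup>2 - (b k)\<^sup>2) ^ Suc k * (1 - b k) ^ n)"
    proof -
      have "real (n - Suc k) = real n - real (Suc k)" using elim(4) by (intro of_nat_diff) simp
      then show ?thesis
        unfolding q unfolding bk l_def by (simp only: power_mult_distrib power_divide of_nat_power) simp
    qed
    also have "\<dots> \<le> measure (\<Omega> n) {\<omega> \<in> space (\<Omega> n). \<forall>i<Suc k. a i < jump_time n (M n) (Suc i) \<omega> \<and> jump_time n (M n) (Suc i) \<omega> \<le> b i}"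
      using elim(2,4) n
      by (intro prob_jump_times_ge[where a = a and b = b and k = k, OF prob mono regular a0 ab ba bk1]) (simp_all only: d q, simp_all)
    also have "\<dots> = measure (\<Omega> n) (?Y n -` grid_cell (Suc k) m c \<inter> space (\<Omega> n))"
    proof (rule arg_cong[where f = "measure (\<Omega> n)"])
      have "a i < t \<longleftrightarrow> real (c i) / real m < real n * t" "t \<le> b i \<longleftrightarrow> real n * t \<le> (real (c i) + 1) / real m" for i t
        using m n by (simp_all add: a_def b_def field_simps)
      then show "{\<omega> \<in> space (\<Omega> n). \<forall>i<Suc k. a i < jump_time n (M n) (Suc i) \<omega> \<and> jump_time n (M n) (Suc i) \<omega> \<le> b i}
        = ?Y n -` grid_cell (Suc k) m c \<inter> space (\<Omega> n)"
        by (auto simp: grid_cell_def)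
    qed
    also have "\<dots> = measure (distr (\<Omega> n) borel (?Y n)) (grid_cell (Suc k) m c)"
      by (rule measure_distr[OF Y grid_cell_in_borel, symmetric])
    finally show ?case using elim(1) by linarith
  qed
qed

theorem theorem3:
  fixes \<Omega> :: "nat \<Rightarrow> 'a measure"
    and M :: "nat \<Rightarrow> real \<Rightarrow> 'a \<Rightarrow> (nat \<Rightarrow> nat)"
  assumes "\<And>n. prob_space (\<Omega> n)"
    and "\<And>n. monotone_mallows_process n (\<Omega> n) (M n)"
  shows "(\<forall>k\<ge>1. weak_conv_m
            (\<lambda>n. distr (\<Omega> n) borel (\<lambda>\<omega>. real n * jump_time n (M n) k \<omega>)) (gamma_law k)) \<and>
         ((\<forall>n. regular_mallows_process n (\<Omega> n) (M n)) \<longrightarrow>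
         (\<forall>k\<ge>1. weak_conv_top
            (\<lambda>n. distr (\<Omega> n) borel
               (\<lambda>\<omega> i. if i < k then real n * jump_time n (M n) (Suc i) \<omega> else 0))
            (poisson_first_points k)))"
proof (intro conjI allI impI)
  fix k :: nat assume "1 \<le> k"
  then show "weak_conv_m (\<lambda>n. distr (\<Omega> n) borel (\<lambda>\<omega>. real n * jump_time n (M n) k \<omega>)) (gamma_law k)"
    by (intro weak_conv_jump_time_gamma assms)
next
  fix k :: nat assume regular: "\<forall>n. regular_mallows_process n (\<Omega> n) (M n)" and "1 \<le> k"
  then obtain k' where "k = Suc k'" by (cases k) auto
  with regular show "weak_conv_top
      (\<lambda>n. distr (\<Omega> n) borel (\<lambda>\<omega> i. if i < k then real n * jump_time n (M n) (Suc i) \<omega> else 0))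
      (poisson_first_points k)"
    using weak_conv_jump_times_poisson[OF assms, of k'] by simp
qed

end
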